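(* Let $n=2^K$ and let the particle number $k$ satisfy $4k\le n$. Let $W$ be the single-particle unitary of the unitary butterfly at uniformly random initialization (all angles independent and uniform on $[0,2\pi)$) and let $|\psi(x)\rangle$ be the data-encoded input. Then there exist a two-body correlator $M=n_in_j$ ($i\neq j$) and a trainable RBS parameter $\theta$ of the butterfly such that, with $\mathcal L=\langle\psi(x)|\Lambda^k(W)^\dagger M\,\Lambda^k(W)|\psi(x)\rangle$, $$\mathrm{Var}\left[\frac{\partial\mathcal L}{\partial\theta}\right]\ge\frac{k^2(k-1)^2}{2\,n^6}.$$
   Context: Encoding. Modes $0,\dots,n-1$; $k\ge2$ even; $f_j^\dagger,f_j$ fermionic creation/annihilation operators, $n_j=f_j^\dagger f_j$. The $k$-particle space is $\Lambda^k\mathbb C^n$; $W\in U(n)$ acts on it as $\Lambda^k(W)$. $|\Psi_{\rm in}\rangle=\prod_{b=0}^{k/2-1}\frac{1}{\sqrt2}(f^\dagger_{4b}f^\dagger_{4b+1}+f^\dagger_{4b+2}f^\dagger_{4b+3})|\mathrm{vac}\rangle$; $H_{pq}=(-1)^{\langle p,q\rangle}/\sqrt n$ is the normalized Walsh--Hadamard matrix ($\langle p,q\rangle$ = mod-2 inner product of binary expansions); data $x$ enters through arbitrary real angles $\varphi_j(x)$, $D(x)=\mathrm{diag}(e^{-i\varphi_j(x)})$, and $|\psi(x)\rangle=\Lambda^k(D(x)H)|\Psi_{\rm in}\rangle$. Unitary butterfly (single-particle picture): $W=U^{(K)}\cdots U^{(1)}$ with $U^{(\ell)}=R_\ell\,\mathrm{diag}(e^{-i\phi_\ell^{(0)}},\dots,e^{-i\phi_\ell^{(n-1)}})$,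 where $R_\ell$ applies, on each of the $n/2$ disjoint pairs $(a,b)$, $b=a\oplus2^{\ell-1}$, $a<b$ (XOR of binary labels), the real rotation $\begin{pmatrix}\cos\theta&-\sin\theta\\ \sin\theta&\cos\theta\end{pmatrix}$ with its own angle $\theta$ (an RBS parameter). The variance is over all angles. *)

theory Defs
  imports "HOL-Probability.Probability" "Jordan_Normal_Form.Matrix"
begin

section \<open>Fermionic Fock space in the occupation-number basis\<close>

text \<open>
  A Fock vector is given by its amplitudes on the basis vectors indexed by finite sets of
  occupied modes; the set \<open>{t\<^sub>1 < \<dots> < t\<^sub>k}\<close> stands for
  \<open>f\<^sup>\<dagger>(t\<^sub>1) \<cdots> f\<^sup>\<dagger>(t\<^sub>k) |vac\<rangle>\<close>, i.e. for
  \<open>e(t\<^sub>1) \<and> \<cdots> \<and> e(t\<^sub>k)\<close> in the exterior power.  With this ordering, creating or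
  annihilating mode \<open>j\<close> produces the sign \<open>(-1)\<close> to the number of occupied modes below \<open>j\<close>.
\<close>

type_synonym fock = "nat set \<Rightarrow> complex"

definition vac :: fock where
  "vac S = (if S = {} then 1 else 0)"

definition creation :: "nat \<Rightarrow> fock \<Rightarrow> fock" where
  "creation j \<psi> S = (if j \<in> S then (-1) ^ card {i \<in> S. i < j} * \<psi> (S - {j}) else 0)"

definition annihilation :: "nat \<Rightarrow> fock \<Rightarrow> fock" where
  "annihilation j \<psi> S = (if j \<in> S then 0 else (-1) ^ card {i \<in> S. i < j} * \<psi> (insert j S))"

definition number_op :: "nat \<Rightarrow> fock \<Rightarrow> fock" where
  "number_op j \<psi> = creation j (annihilation j \<psi>)"

definition fock_inner :: "nat \<Rightarrow> fock \<Rightarrow> fock \<Rightarrow> complex" where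
  "fock_inner n \<psi> \<eta> = (\<Sum>S\<in>Pow {..<n}. cnj (\<psi> S) * \<eta> S)"

text \<open>\<open>col_creation W t\<close> is \<open>f\<^sup>\<dagger>(W e\<^sub>t) = (\<Sum>i. W\<^sub>i\<^sub>t f\<^sup>\<dagger>(i))\<close>.\<close>

definition col_creation :: "complex mat \<Rightarrow> nat \<Rightarrow> fock \<Rightarrow> fock" where
  "col_creation W t \<psi> S = (\<Sum>i<dim_row W. W $$ (i, t) * creation i \<psi> S)"

text \<open>
  The \<open>k\<close>-th exterior power of \<open>W\<close>: the linear map with
  \<open>e(t\<^sub>1) \<and> \<cdots> \<and> e(t\<^sub>k) \<mapsto> W e(t\<^sub>1) \<and> \<cdots> \<and> W e(t\<^sub>k)\<close>.
\<close>

definition ext_power :: "nat \<Rightarrow> complex mat \<Rightarrow> fock \<Rightarrow> fock" where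
  "ext_power k W \<psi> S =
     (\<Sum>T | T \<subseteq> {..<dim_col W} \<and> card T = k.
        \<psi> T * foldr (col_creation W) (sorted_list_of_set T) vac S)"


section \<open>Input state and data encoding\<close>

text \<open>\<open>pair_state m\<close> is the product over the first \<open>m\<close> blocks, so the input state is
  \<open>pair_state (k div 2)\<close>.\<close>

primrec pair_state :: "nat \<Rightarrow> fock" where
  "pair_state 0 = vac"
| "pair_state (Suc b) = (\<lambda>S. complex_of_real (1 / sqrt 2) *
     (creation (4*b) (creation (4*b+1) (pair_state b)) S
      + creation (4*b+2) (creation (4*b+3) (pair_state b)) S))"

definition hadamard :: "nat \<Rightarrow> complex mat" where
  "hadamard K = Matrix.mat (2^K) (2^K)
     (\<lambda>(p, q). (-1) ^ card {l. l < K \<and> bit p l \<and> bit q l} / complex_of_real (sqrt (2^K)))"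

definition phase_diag :: "nat \<Rightarrow> (nat \<Rightarrow> real) \<Rightarrow> complex mat" where
  "phase_diag n \<phi> = mat_diag n (\<lambda>j. exp (- \<i> * complex_of_real (\<phi> j)))"

definition encoded_state :: "nat \<Rightarrow> nat \<Rightarrow> (nat \<Rightarrow> real) \<Rightarrow> fock" where
  "encoded_state K k \<phi> =
     ext_power k (phase_diag (2^K) \<phi> * hadamard K) (pair_state (k div 2))"


section \<open>The unitary butterfly\<close>

text \<open>
  \<open>RBS l a\<close> is the rotation angle in layer \<open>l\<close> of the pair whose smaller member is \<open>a\<close>;
  \<open>Phase l j\<close> is the phase angle of mode \<open>j\<close> in layer \<open>l\<close>.
\<close>

datatype angle = RBS nat nat | Phase nat nat

definition partner :: "nat \<Rightarrow> nat \<Rightarrow> nat" where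
  "partner l a = xor a (2 ^ (l - 1))"

definition rbs_angles :: "nat \<Rightarrow> angle set" where
  "rbs_angles K = {RBS l a | l a. l \<in> {1..K} \<and> a < 2^K \<and> a < partner l a}"

definition phase_angles :: "nat \<Rightarrow> angle set" where
  "phase_angles K = {Phase l j | l j. l \<in> {1..K} \<and> j < 2^K}"

definition rbs_layer :: "nat \<Rightarrow> nat \<Rightarrow> (angle \<Rightarrow> real) \<Rightarrow> complex mat" where
  "rbs_layer K l \<omega> = Matrix.mat (2^K) (2^K) (\<lambda>(p, q).
     let \<theta> = \<omega> (RBS l (min p (partner l p))) in
     if q = p then complex_of_real (cos \<theta>)
     else if q = partner l p then complex_of_real (if p < q then - sin \<theta> else sin \<theta>)
     else 0)"

definition butterfly_layer :: "nat \<Rightarrow> nat \<Rightarrow> (angle \<Rightarrow> real) \<Rightarrow> complex mat" where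
  "butterfly_layer K l \<omega> = rbs_layer K l \<omega> * phase_diag (2^K) (\<lambda>j. \<omega> (Phase l j))"

primrec butterfly_upto :: "nat \<Rightarrow> (angle \<Rightarrow> real) \<Rightarrow> nat \<Rightarrow> complex mat" where
  "butterfly_upto K \<omega> 0 = 1\<^sub>m (2^K)"
| "butterfly_upto K \<omega> (Suc l) = butterfly_layer K (Suc l) \<omega> * butterfly_upto K \<omega> l"

definition butterfly :: "nat \<Rightarrow> (angle \<Rightarrow> real) \<Rightarrow> complex mat" where
  "butterfly K \<omega> = butterfly_upto K \<omega> K"

definition random_init :: "nat \<Rightarrow> (angle \<Rightarrow> real) measure" where
  "random_init K =
     Pi\<^sub>M (rbs_angles K \<union> phase_angles K) (\<lambda>_. uniform_measure lborel {0..<2 * pi})"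


section \<open>Loss and gradient\<close>

text \<open>The expectation value of \<open>n\<^sub>i n\<^sub>j\<close> is real, since \<open>n\<^sub>i\<close> and \<open>n\<^sub>j\<close> are commuting
  self-adjoint operators; \<open>Re\<close> only changes the type.\<close>

definition loss :: "nat \<Rightarrow> nat \<Rightarrow> (nat \<Rightarrow> real) \<Rightarrow> nat \<Rightarrow> nat \<Rightarrow> (angle \<Rightarrow> real) \<Rightarrow> real" where
  "loss K k \<phi> i j \<omega> =
     (let \<psi> = ext_power k (butterfly K \<omega>) (encoded_state K k \<phi>)
      in Re (fock_inner (2^K) \<psi> (number_op i (number_op j \<psi>))))"

definition partial_deriv :: "((angle \<Rightarrow> real) \<Rightarrow> real) \<Rightarrow> angle \<Rightarrow> (angle \<Rightarrow> real) \<Rightarrow> real" where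
  "partial_deriv L \<theta> \<omega> = deriv (\<lambda>t. L (fun_upd \<omega> \<theta> t)) (\<omega> \<theta>)"

end

theory Submission
  imports Defs
begin

text \<open>
  Since exterior powers of isometries are isometries and intertwine annihilation operators, the loss
  for \<open>n\<^sub>i n\<^sub>j\<close> is the squared norm of \<open>\<Sum>p q. W\<^sub>i\<^sub>p W\<^sub>j\<^sub>q f\<^sub>p f\<^sub>q \<psi>\<close>.  Averaging over the rotation angles of
  one layer turns it into a Markov step for the pair \<open>(i, j)\<close>: each index flips one bit with probability
  \<open>1/2\<close>, independently, unless \<open>i\<close> and \<open>j\<close> are partners, in which case nothing happens.

  Let \<open>\<theta>\<close> and \<open>\<theta>'\<close> be the last-layer angles of \<open>i\<close> and \<open>j = i xor 2^m\<close>.  The covariance of the derivative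
  with \<open>sin 2\<theta> cos 2\<theta>'\<close> compares the mean pair weights of the pairs with equal and with different top
  bits.  The latter never meet; the former do, and only this exclusion makes a difference, because the
  input occupies at most half of the modes, so that \<open>f\<^sub>p \<psi>\<close> and \<open>f\<^sub>p\<^sub>' \<psi>\<close> with \<open>p' = p xor n/2\<close> agree up to a
  phase.  The total effect of the exclusion, telescoped over \<open>m\<close>, is governed by
  \<open>\<Sum>p q. |f\<^sub>p f\<^sub>q \<psi>|\<^sup>2 = k (k - 1)\<close>, hence it is large for some \<open>m\<close> and \<open>i\<close>.
\<close>

section \<open>Exterior powers of isometries\<close>

text \<open>The variance is quadratic in the pair weights, and second moments of a deep circuit are
  hard to control. Pairing the derivative with a test function of two angles replaces them by first
  moments, which evolve linearly from layer to layer. The last layer is chosen because there the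
  angle enters only one of the two rows in the loss, so the derivative is an explicit combination of
  \<open>sin (2 * theta)\<close> and \<open>cos (2 * theta)\<close>.

  Without exclusion the four means compared would coincide, so the whole signal is the exclusion
  defect. Its size comes from the Pauli principle: with \<open>s = k (k - 1)\<close> and
  \<open>n = 2 ^ (N + 1)\<close>, free walkers start with no mass on the diagonal and end uniform,
  with diagonal mass \<open>s / n\<close>. What layer m adds to the free diagonal mass equals the
  excess that exclusion keeps on partner pairs, and each later layer halves this excess. The weights
  \<open>2 ^ (N - 1 - m)\<close> sum to less than \<open>n / 2\<close>, so some m and a give a
  combined defect d of at least \<open>4 s / n^3\<close>. Covariance \<open>- d / 8\<close> against
  second moment \<open>1 / 4\<close> yields variance at least \<open>d^2 / 16\<close>.\<close>

lemma card_below_insert: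
  assumes "i \<notin> S"
  shows "card {x \<in> insert i S. x < j} = card {x \<in> S. x < (j::nat)} + (if i < j then 1 else 0)"
proof -
  have "{x \<in> insert i S. x < j} = (if i < j then insert i {x \<in> S. x < j} else {x \<in> S. x < j})"
    by auto
  moreover have "finite {x \<in> S. x < j}" by simp
  ultimately show ?thesis using assms by simp
qed

text \<open>The Jordan-Wigner sign, kept as a complex number so that adding or removing a mode acts
  on it by plain negation instead of a parity computation.\<close>

definition below_sign :: "nat set \<Rightarrow> nat \<Rightarrow> complex" where
  "below_sign S j = (-1) ^ card {i \<in> S. i < j}"

lemma creation_below_sign:
  "creation j \<psi> S = (if j \<in> S then below_sign S j * \<psi> (S - {j}) else 0)"
  by (simp add: creation_def below_sign_def)

lemma annihilation_below_sign:
  "annihilation j \<psi> S = (if j \<in> S then 0 else below_sign S j * \<psi> (insert j S))"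
  by (simp add: annihilation_def below_sign_def)

lemma below_sign_insert:
  "i \<notin> S \<Longrightarrow> below_sign (insert i S) j = (if i < j then - below_sign S j else below_sign S j)"
  using card_below_insert[of i S j] by (simp add: below_sign_def)

lemma below_sign_remove:
  "i \<in> S \<Longrightarrow> below_sign (S - {i}) j = (if i < j then - below_sign S j else below_sign S j)"
  using below_sign_insert[of i "S - {i}" j] by (auto simp: insert_absorb split: if_splits)

lemma below_sign_square: "below_sign S j * (below_sign S j * z) = z"
  by (simp add: below_sign_def mult.assoc[symmetric] power_mult_distrib[symmetric])

lemma cmod_below_sign: "cmod (below_sign S j) = 1"
  by (simp add: below_sign_def norm_power)

text \<open>Canonical anticommutation relation. Of two distinct modes exactly one lies below the
  other, so exactly one of the two orders of application picks up an extra sign.\<close>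

lemma annihilation_creation:
  "annihilation i (creation j \<psi>) S = (if i = j then \<psi> S else 0) - creation j (annihilation i \<psi>) S"
proof (cases "i = j")
  case True
  then show ?thesis
    by (simp add: annihilation_below_sign creation_below_sign below_sign_insert below_sign_remove
        below_sign_square insert_absorb)
next
  case False
  then have "insert i S - {j} = insert i (S - {j})" by auto
  then show ?thesis using False
    by (auto simp: annihilation_below_sign creation_below_sign below_sign_insert below_sign_remove)
qed

lemma annihilation_anticommute:
  "annihilation i (annihilation j \<psi>) S = - annihilation j (annihilation i \<psi>) S"
  by (auto simp: annihilation_below_sign below_sign_insert insert_commute)

lemma annihilation_sum:
  "annihilation i (\<lambda>S. \<Sum>x\<in>A. c x * f x S) S = (\<Sum>x\<in>A. c x * annihilation i (f x) S)"
  by (auto simp: annihilation_below_sign sum_distrib_left mult_ac)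

lemma creation_sum:
  "creation i (\<lambda>S. \<Sum>x\<in>A. c x * f x S) S = (\<Sum>x\<in>A. c x * creation i (f x) S)"
  by (auto simp: creation_below_sign sum_distrib_left mult_ac)

lemma annihilation_scale: "annihilation i (\<lambda>S. c * f S) S = c * annihilation i f S"
  by (auto simp: annihilation_def)

lemma number_op_apply: "number_op j \<psi> S = (if j \<in> S then \<psi> S else 0)"
proof -
  have "number_op j \<psi> S = \<psi> S - annihilation j (creation j \<psi>) S"
    unfolding number_op_def using annihilation_creation[of j j \<psi> S] by simp
  moreover have "number_op j \<psi> S = 0" if "j \<notin> S"
    using that by (simp add: number_op_def creation_def)
  moreover have "annihilation j (creation j \<psi>) S = 0" if "j \<in> S"
    using that by (simp add: annihilation_def)
  ultimately show ?thesis by auto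
qed

section \<open>Annihilation operators and exterior powers\<close>

text \<open>The Heisenberg picture of \<open>annihilation i\<close> under the exterior power of
  \<open>W\<close>: row \<open>i\<close> acts as a linear form contracted with the state, hence no
  complex conjugates.\<close>

definition annihilate_row :: "complex mat \<Rightarrow> nat \<Rightarrow> fock \<Rightarrow> fock" where
  "annihilate_row W i \<psi> S = (\<Sum>p<dim_col W. W $$ (i, p) * annihilation p \<psi> S)"

abbreviation wedge :: "complex mat \<Rightarrow> nat set \<Rightarrow> fock" where
  "wedge W T \<equiv> foldr (col_creation W) (sorted_list_of_set T) vac"

lemma annihilation_col_creation:
  assumes "i < dim_row W"
  shows "annihilation i (col_creation W t \<psi>) S
    = W $$ (i, t) * \<psi> S - col_creation W t (annihilation i \<psi>) S"
proof -
  have "annihilation i (col_creation W t \<psi>) S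
      = (\<Sum>j<dim_row W. W $$ (j, t) * annihilation i (creation j \<psi>) S)"
    using annihilation_sum[of i "\<lambda>j. W $$ (j, t)" "\<lambda>j. creation j \<psi>" "{..<dim_row W}" S]
    by (simp add: col_creation_def[abs_def])
  also have "\<dots> = (\<Sum>j<dim_row W. (if j = i then W $$ (i, t) * \<psi> S else 0)
      - W $$ (j, t) * creation j (annihilation i \<psi>) S)"
    by (intro sum.cong) (auto simp: annihilation_creation algebra_simps)
  also have "\<dots> = W $$ (i, t) * \<psi> S - col_creation W t (annihilation i \<psi>) S"
    using assms by (simp add: sum_subtractf col_creation_def)
  finally show ?thesis .
qed

lemma col_creation_sum:
  "col_creation W t (\<lambda>S. \<Sum>x\<in>A. c x * f x S) S = (\<Sum>x\<in>A. c x * col_creation W t (f x) S)"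
  unfolding col_creation_def creation_sum sum_distrib_left
  by (subst sum.swap) (simp add: mult_ac)

lemma wedge_insert_min:
  assumes "finite T" "\<forall>s\<in>T. t < s"
  shows "wedge W (insert t T) = col_creation W t (wedge W T)"
proof -
  have "sorted_list_of_set (insert t T) = t # sorted_list_of_set T"
    using assms by (subst sorted_list_of_set_insert)
      (auto simp: insort_is_Cons less_imp_le)
  then show ?thesis by simp
qed

text \<open>Contraction is an antiderivation of the wedge product: reaching the factor of
  \<open>p\<close> means passing all smaller modes of \<open>T\<close>, which costs
  \<open>below_sign T p\<close>. The induction adds a new smallest mode because the sorted list puts
  that factor in front.\<close>

lemma annihilation_wedge:
  assumes "finite T" "i < dim_row W"
  shows "annihilation i (wedge W T) S
    = (\<Sum>p\<in>T. below_sign T p * W $$ (i, p) * wedge W (T - {p}) S)"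
  using assms(1)
proof (induction T arbitrary: S rule: finite_linorder_min_induct)
  case empty
  then show ?case by (auto simp: annihilation_def vac_def)
next
  case (insert t T)
  have t: "t \<notin> T" using insert by auto
  have IH: "annihilation i (wedge W T)
    = (\<lambda>S. \<Sum>p\<in>T. (below_sign T p * W $$ (i, p)) * wedge W (T - {p}) S)"
    using insert.IH by auto
  have sg: "below_sign (insert t T) p = - below_sign T p"
    if "p \<in> T" for p
    using insert.hyps that t by (simp add: below_sign_insert)
  have w: "wedge W (insert t T - {p}) = col_creation W t (wedge W (T - {p}))" if "p \<in> T" for p
  proof -
    have "insert t T - {p} = insert t (T - {p})" using that t by auto
    moreover have "wedge W (insert t (T - {p})) = col_creation W t (wedge W (T - {p}))"
      using insert.hyps by (intro wedge_insert_min) auto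
    ultimately show ?thesis by simp
  qed
  have "annihilation i (wedge W (insert t T)) S
     = W $$ (i, t) * wedge W T S - col_creation W t (annihilation i (wedge W T)) S"
    using insert.hyps by (simp only: wedge_insert_min annihilation_col_creation[OF assms(2)])
  also have "col_creation W t (annihilation i (wedge W T)) S
     = (\<Sum>p\<in>T. (below_sign T p * W $$ (i, p)) * col_creation W t (wedge W (T - {p})) S)"
    unfolding IH col_creation_sum ..
  also have "W $$ (i, t) * wedge W T S - \<dots>
     = W $$ (i, t) * wedge W T S + (\<Sum>p\<in>T. below_sign (insert t T) p * W $$ (i, p)
          * wedge W (insert t T - {p}) S)"
    by (simp add: sg w sum_negf)
  also have "W $$ (i, t) * wedge W T S = below_sign (insert t T) t * W $$ (i, t)
          * wedge W (insert t T - {t}) S"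
  proof -
    have "{x \<in> insert t T. x < t} = {}" using insert.hyps by auto
    then have "below_sign (insert t T) t = 1" by (simp only: below_sign_def card.empty power_0)
    moreover have "insert t T - {t} = T" using t by auto
    ultimately show ?thesis by simp
  qed
  finally show ?case using t insert.hyps by (simp add: sum.insert)
qed

section \<open>Sums over sets of k modes\<close>

definition k_sets :: "nat \<Rightarrow> nat \<Rightarrow> nat set set" where
  "k_sets n k = {T. T \<subseteq> {..<n} \<and> card T = k}"

lemma finite_k_sets: "finite (k_sets n k)"
  unfolding k_sets_def by (rule finite_subset[of _ "Pow {..<n}"]) auto

lemma k_sets_finite: "T \<in> k_sets n k \<Longrightarrow> finite T"
  unfolding k_sets_def using finite_subset by auto

text \<open>Double counting of sets with a marked element: mark an element of the larger set, or add
  a new element to the smaller one.\<close>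

lemma sum_k_sets_Suc:
  fixes g :: "nat set \<Rightarrow> nat \<Rightarrow> 'a :: comm_monoid_add"
  shows "(\<Sum>T\<in>k_sets n (Suc k). \<Sum>p\<in>T. g T p)
    = (\<Sum>T\<in>k_sets n k. \<Sum>p\<in>{..<n} - T. g (insert p T) p)"
proof -
  have "(\<Sum>T\<in>k_sets n (Suc k). \<Sum>p\<in>T. g T p)
      = (\<Sum>(T, p)\<in>Sigma (k_sets n (Suc k)) (\<lambda>T. T). g T p)"
    using finite_k_sets k_sets_finite by (intro sum.Sigma) blast+
  also have "\<dots> = (\<Sum>(T, p)\<in>Sigma (k_sets n k) (\<lambda>T. {..<n} - T). g (insert p T) p)"
  proof (rule sum.reindex_bij_witness[where i="\<lambda>(T, p). (insert p T, p)" and j="\<lambda>(T, p). (T - {p}, p)"],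
      goal_cases)
    case (1 a) then show ?case by (auto simp: insert_absorb)
  next
    case (2 a)
    obtain T p where a: "a = (T, p)" by force
    with 2 have T: "T \<subseteq> {..<n}" "card T = Suc k" and p: "p \<in> T" by (auto simp: k_sets_def)
    then show ?case using a by (auto simp: k_sets_def)
  next
    case (3 a) then show ?case by auto
  next
    case (4 b)
    obtain T p where b: "b = (T, p)" by force
    with 4 have T: "T \<in> k_sets n k" and p: "p < n" "p \<notin> T" by auto
    have "card (insert p T) = Suc k" using k_sets_finite[OF T] T p by (simp add: k_sets_def)
    then show ?case using T p b by (simp add: k_sets_def)
  next
    case (5 a)
    then show ?case by (auto simp: insert_absorb)
  qed
  also have "\<dots> = (\<Sum>T\<in>k_sets n k. \<Sum>p\<in>{..<n} - T. g (insert p T) p)"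
    using finite_k_sets by (intro sum.Sigma[symmetric]) auto
  finally show ?thesis .
qed

text \<open>The squared norm of \<open>f_p psi\<close> is the expected occupation of mode
  \<open>p\<close>; the sum over all modes is the expectation of the total particle number.\<close>

lemma sum_norm_annihilation:
  "(\<Sum>p<n. \<Sum>T\<in>k_sets n k. (cmod (annihilation p \<psi> T))\<^sup>2)
    = real (Suc k) * (\<Sum>T\<in>k_sets n (Suc k). (cmod (\<psi> T))\<^sup>2)"
proof -
  have "(\<Sum>p<n. (cmod (annihilation p \<psi> T))\<^sup>2) = (\<Sum>p\<in>{..<n} - T. (cmod (\<psi> (insert p T)))\<^sup>2)" for T
  proof -
    have "(\<Sum>p<n. (cmod (annihilation p \<psi> T))\<^sup>2) = (\<Sum>p\<in>{..<n} - T. (cmod (annihilation p \<psi> T))\<^sup>2)"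
      by (intro sum.mono_neutral_right) (auto simp: annihilation_def)
    also have "\<dots> = (\<Sum>p\<in>{..<n} - T. (cmod (\<psi> (insert p T)))\<^sup>2)"
      by (intro sum.cong) (auto simp: annihilation_below_sign norm_mult cmod_below_sign)
    finally show ?thesis .
  qed
  then have "(\<Sum>p<n. \<Sum>T\<in>k_sets n k. (cmod (annihilation p \<psi> T))\<^sup>2)
      = (\<Sum>T\<in>k_sets n k. \<Sum>p\<in>{..<n} - T. (cmod (\<psi> (insert p T)))\<^sup>2)"
    by (subst sum.swap) simp
  also have "\<dots> = (\<Sum>T\<in>k_sets n (Suc k). \<Sum>p\<in>T. (cmod (\<psi> T))\<^sup>2)"
    by (rule sum_k_sets_Suc[symmetric])
  also have "\<dots> = real (Suc k) * (\<Sum>T\<in>k_sets n (Suc k). (cmod (\<psi> T))\<^sup>2)"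
    by (simp add: sum_distrib_left k_sets_def)
  finally show ?thesis .
qed

text \<open>The expansion in \<open>annihilation_wedge\<close> runs over sets with a marked element.
  Regrouping by the remaining set moves the contraction from the wedge products to the coefficients.
  Lowering the particle number this way makes induction on \<open>k\<close> possible.\<close>

lemma annihilation_ext_power:
  assumes "i < dim_row W"
  shows "annihilation i (ext_power (Suc k) W \<psi>) S = ext_power k W (annihilate_row W i \<psi>) S"
proof -
  let ?n = "dim_col W"
  have ext: "ext_power k W \<psi> S = (\<Sum>T\<in>k_sets ?n k. \<psi> T * wedge W T S)" for k \<psi> S
    by (simp add: ext_power_def k_sets_def)
  have "annihilation i (ext_power (Suc k) W \<psi>) S
      = (\<Sum>T\<in>k_sets ?n (Suc k). \<psi> T * annihilation i (wedge W T) S)"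
    using annihilation_sum[of i \<psi> "wedge W" "k_sets ?n (Suc k)" S] by (simp add: ext[abs_def])
  also have "\<dots> = (\<Sum>T\<in>k_sets ?n (Suc k). \<Sum>p\<in>T.
      \<psi> T * (below_sign T p * W $$ (i, p) * wedge W (T - {p}) S))"
    by (intro sum.cong refl, subst annihilation_wedge[OF k_sets_finite assms])
      (auto simp: sum_distrib_left)
  also have "\<dots> = (\<Sum>T\<in>k_sets ?n k. \<Sum>p\<in>{..<?n} - T.
      \<psi> (insert p T) * (below_sign (insert p T) p * W $$ (i, p) * wedge W (insert p T - {p}) S))"
    by (rule sum_k_sets_Suc)
  also have "\<dots> = (\<Sum>T\<in>k_sets ?n k. annihilate_row W i \<psi> T * wedge W T S)"
  proof (intro sum.cong refl)
    fix T
    have "(\<Sum>p\<in>{..<?n} - T.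
        \<psi> (insert p T) * (below_sign (insert p T) p * W $$ (i, p) * wedge W (insert p T - {p}) S))
      = (\<Sum>p\<in>{..<?n} - T. W $$ (i, p) * annihilation p \<psi> T * wedge W T S)"
      by (intro sum.cong refl) (simp add: annihilation_below_sign below_sign_insert)
    also have "\<dots> = (\<Sum>p<?n. W $$ (i, p) * annihilation p \<psi> T * wedge W T S)"
      by (intro sum.mono_neutral_left) (auto simp: annihilation_def)
    finally show "(\<Sum>p\<in>{..<?n} - T.
        \<psi> (insert p T) * (below_sign (insert p T) p * W $$ (i, p) * wedge W (insert p T - {p}) S))
      = annihilate_row W i \<psi> T * wedge W T S"
      by (simp add: annihilate_row_def sum_distrib_right)
  qed
  finally show ?thesis by (simp add: ext)
qed

text \<open>Isometry in the form in which it is consumed: \<open>z p\<close> will be the amplitude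
  of \<open>annihilation p\<close> applied to a state, at a fixed basis vector.\<close>

definition norm_preserving :: "complex mat \<Rightarrow> bool" where
  "norm_preserving U \<longleftrightarrow> (\<forall>z. (\<Sum>i<dim_row U. (cmod (\<Sum>p<dim_col U. U $$ (i, p) * z p))\<^sup>2)
     = (\<Sum>p<dim_col U. (cmod (z p))\<^sup>2))"

text \<open>The particle-number identity expresses the norm of a state through its annihilated
  states. Annihilation passes through the exterior power, the induction hypothesis removes that
  power, and the isometry of \<open>U\<close> settles the sum over its rows, so no minors have to be
  computed.\<close>

lemma norm_ext_power:
  assumes "norm_preserving U"
  shows "(\<Sum>S\<in>k_sets (dim_row U) k. (cmod (ext_power k U \<psi> S))\<^sup>2)
    = (\<Sum>T\<in>k_sets (dim_col U) k. (cmod (\<psi> T))\<^sup>2)"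
proof (induction k arbitrary: \<psi>)
  case 0
  have "k_sets n 0 = {{}}" for n by (auto simp: k_sets_def dest: finite_subset)
  then show ?case by (simp add: ext_power_def vac_def k_sets_def[symmetric])
next
  case (Suc k)
  let ?m = "dim_row U" and ?n = "dim_col U"
  have "real (Suc k) * (\<Sum>S\<in>k_sets ?m (Suc k). (cmod (ext_power (Suc k) U \<psi> S))\<^sup>2)
      = (\<Sum>i<?m. \<Sum>S\<in>k_sets ?m k. (cmod (ext_power k U (annihilate_row U i \<psi>) S))\<^sup>2)"
    by (subst sum_norm_annihilation[symmetric]) (simp add: annihilation_ext_power)
  also have "\<dots> = (\<Sum>T\<in>k_sets ?n k. \<Sum>i<?m. (cmod (annihilate_row U i \<psi> T))\<^sup>2)"
    by (subst sum.swap) (simp add: Suc.IH)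
  also have "\<dots> = (\<Sum>p<?n. \<Sum>T\<in>k_sets ?n k. (cmod (annihilation p \<psi> T))\<^sup>2)"
    using assms by (subst sum.swap) (simp add: annihilate_row_def norm_preserving_def)
  also have "\<dots> = real (Suc k) * (\<Sum>T\<in>k_sets ?n (Suc k). (cmod (\<psi> T))\<^sup>2)"
    by (rule sum_norm_annihilation)
  finally show ?case by simp
qed

lemma wedge_eq_0:
  assumes "finite T" "S \<notin> k_sets (dim_row W) (card T)"
  shows "wedge W T S = 0"
  using assms
proof (induction T arbitrary: S rule: finite_linorder_min_induct)
  case empty
  then show ?case by (auto simp: vac_def k_sets_def)
next
  case (insert t T)
  have "S - {i} \<notin> k_sets (dim_row W) (card T)" if "i < dim_row W" "i \<in> S" for i
  proof
    assume *: "S - {i} \<in> k_sets (dim_row W) (card T)"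
    have "card S = Suc (card T)"
      using * k_sets_finite[OF *] card.remove[of S i] that by (simp add: k_sets_def)
    then have "S \<in> k_sets (dim_row W) (card (insert t T))"
      using * that insert.hyps by (auto simp: k_sets_def)
    then show False using insert.prems by simp
  qed
  then have "creation i (wedge W T) S = 0" if "i < dim_row W" for i
    using that insert.IH by (simp add: creation_def)
  then have "col_creation W t (wedge W T) S = 0" by (simp add: col_creation_def)
  then show ?case using insert.hyps by (simp only: wedge_insert_min)
qed

lemma ext_power_eq_0: "S \<notin> k_sets (dim_row W) k \<Longrightarrow> ext_power k W \<psi> S = 0"
  unfolding ext_power_def
  by (intro sum.neutral) (auto intro!: wedge_eq_0 intro: finite_subset)

text \<open>Since \<open>i\<close> and \<open>j\<close> are distinct, the expectation of
  \<open>n_i n_j\<close> is the squared norm of \<open>f_i f_j\<close> applied to the output. Two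
  intertwinings carry both operators to the input, and the exterior power that remains is
  isometric.\<close>

lemma pair_correlator_ext_power:
  assumes W: "norm_preserving W" "dim_row W = n" "dim_col W = n"
    and ij: "i < n" "j < n" "i \<noteq> j"
  shows "Re (fock_inner n (ext_power (Suc (Suc k)) W \<eta>)
            (number_op i (number_op j (ext_power (Suc (Suc k)) W \<eta>))))
    = (\<Sum>S\<in>k_sets n k. (cmod (\<Sum>p<n. \<Sum>q<n. W $$ (i, p) * W $$ (j, q)
          * annihilation p (annihilation q \<eta>) S))\<^sup>2)"
proof -
  let ?\<psi> = "ext_power (Suc (Suc k)) W \<eta>"
  have "Re (fock_inner n ?\<psi> (number_op i (number_op j ?\<psi>)))
      = (\<Sum>S\<in>Pow {..<n}. if i \<in> S \<and> j \<in> S then (cmod (?\<psi> S))\<^sup>2 else 0)"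
    unfolding fock_inner_def number_op_apply Re_sum cmod_power2
    by (intro sum.cong) (auto simp: power2_eq_square)
  also have "\<dots> = (\<Sum>S\<in>{S \<in> k_sets n (Suc (Suc k)). i \<in> S \<and> j \<in> S}. (cmod (?\<psi> S))\<^sup>2)"
    using ext_power_eq_0[of _ W "Suc (Suc k)" \<eta>] W
    by (intro sum.mono_neutral_cong_right) (auto simp: k_sets_def)
  also have "\<dots> = (\<Sum>S\<in>{S \<in> k_sets n k. i \<notin> S \<and> j \<notin> S}. (cmod (?\<psi> (insert i (insert j S))))\<^sup>2)"
  proof (rule sum.reindex_bij_witness[where i="\<lambda>S. insert i (insert j S)" and j="\<lambda>S. S - {i, j}"],
      goal_cases)
    case (2 S)
    then have "card (S - {i, j}) = k"
      using ij by (subst card_Diff_subset) (auto simp: k_sets_def)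
    then show ?case using 2 by (auto simp: k_sets_def)
  next
    case (4 S)
    then have "finite S" using k_sets_finite by auto
    then show ?case using 4 ij by (auto simp: k_sets_def)
  next
    case (5 S)
    then have "insert i (insert j (S - {i, j})) = S" by auto
    then show ?case by simp
  qed auto
  also have "\<dots> = (\<Sum>S\<in>k_sets n k. (cmod (annihilation i (annihilation j ?\<psi>) S))\<^sup>2)"
    using ij finite_k_sets by (intro sum.mono_neutral_cong_left)
      (auto simp: annihilation_below_sign norm_mult cmod_below_sign insert_commute)
  also have "\<dots> = (\<Sum>S\<in>k_sets n k. (cmod (ext_power k W (annihilate_row W i (annihilate_row W j \<eta>)) S))\<^sup>2)"
  proof -
    have "annihilation j ?\<psi> = ext_power (Suc k) W (annihilate_row W j \<eta>)"
      using ij W by (intro ext annihilation_ext_power) simp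
    then show ?thesis using ij W by (simp add: annihilation_ext_power)
  qed
  also have "\<dots> = (\<Sum>S\<in>k_sets n k. (cmod (annihilate_row W i (annihilate_row W j \<eta>) S))\<^sup>2)"
    using norm_ext_power[OF W(1), of k] W by simp
  finally show ?thesis
    by (simp add: annihilate_row_def[abs_def] annihilation_sum sum_distrib_left mult.assoc W)
qed

section \<open>Norm and support of the input state\<close>

lemma norm_creation:
  assumes "j < n" "\<And>S. j \<in> S \<Longrightarrow> \<psi> S = 0"
  shows "(\<Sum>S\<in>Pow {..<n}. (cmod (creation j \<psi> S))\<^sup>2) = (\<Sum>S\<in>Pow {..<n}. (cmod (\<psi> S))\<^sup>2)"
proof -
  have "(\<Sum>S\<in>Pow {..<n}. (cmod (creation j \<psi> S))\<^sup>2)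
      = (\<Sum>S\<in>{S \<in> Pow {..<n}. j \<in> S}. (cmod (\<psi> (S - {j})))\<^sup>2)"
    by (intro sum.mono_neutral_cong_right) (auto simp: creation_below_sign norm_mult cmod_below_sign)
  also have "\<dots> = (\<Sum>S\<in>{S \<in> Pow {..<n}. j \<notin> S}. (cmod (\<psi> S))\<^sup>2)"
    using assms(1)
    by (intro sum.reindex_bij_witness[where i="insert j" and j="\<lambda>S. S - {j}"]) auto
  also have "\<dots> = (\<Sum>S\<in>Pow {..<n}. (cmod (\<psi> S))\<^sup>2)"
    using assms(2) by (intro sum.mono_neutral_left) auto
  finally show ?thesis .
qed

lemma creation_eq_0:
  assumes "\<And>S. S \<notin> k_sets n k \<Longrightarrow> \<psi> S = 0" "j < n" "S \<notin> k_sets n (Suc k)"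
  shows "creation j \<psi> S = 0"
proof (cases "j \<in> S")
  case True
  have "S - {j} \<notin> k_sets n k"
  proof
    assume *: "S - {j} \<in> k_sets n k"
    have "card S = Suc k"
      using * k_sets_finite[OF *] card.remove[of S j] True by (simp add: k_sets_def)
    then show False using * assms by (auto simp: k_sets_def)
  qed
  then show ?thesis using assms(1) by (simp add: creation_def)
qed (simp add: creation_def)

text \<open>This support bound is what later confines the input to the lower half of the
  modes.\<close>

lemma pair_state_eq_0: "S \<notin> k_sets (4 * m) (2 * m) \<Longrightarrow> pair_state m S = 0"
proof (induction m arbitrary: S)
  case 0
  then show ?case by (auto simp: vac_def k_sets_def)
next
  case (Suc b)
  have "pair_state b S = 0" if "S \<notin> k_sets (4 * Suc b) (2 * b)" for S
    using that by (intro Suc.IH) (auto simp: k_sets_def)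
  from creation_eq_0[OF creation_eq_0[OF this]] Suc.prems show ?case by simp
qed

text \<open>The two terms of a block live on disjoint sets of basis vectors, as mode
  \<open>4*b\<close> is occupied in one and empty in the other. Hence there is no cross term and the
  prefactor \<open>1 / sqrt 2\<close> restores the norm.\<close>

lemma norm_pair_state: "4 * m \<le> n \<Longrightarrow> (\<Sum>S\<in>k_sets n (2 * m). (cmod (pair_state m S))\<^sup>2) = 1"
proof -
  assume "4 * m \<le> n"
  then have "(\<Sum>S\<in>Pow {..<n}. (cmod (pair_state m S))\<^sup>2) = 1"
  proof (induction m)
    case 0
    have "(\<Sum>S\<in>Pow {..<n}. (cmod (pair_state 0 S))\<^sup>2) = (\<Sum>S\<in>Pow {..<n}. if S = {} then 1 else 0)"
      by (intro sum.cong) (auto simp: vac_def)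
    then show ?case by (simp add: sum.delta)
  next
    case (Suc b)
    have z: "pair_state b S = 0" if "4 * b + c \<in> S" for c S
      using that by (intro pair_state_eq_0) (auto simp: k_sets_def)
    define X where "X c = creation (4*b+c) (creation (4*b+c+1) (pair_state b))" for c
    have X0: "X c S = 0" if "4 * b + c \<notin> S \<or> 4 * b + d \<in> S" "d \<noteq> c" "d \<noteq> c + 1" for c d S
      using that z[of d] by (auto simp: X_def creation_def)
    have nX: "(\<Sum>S\<in>Pow {..<n}. (cmod (X c S))\<^sup>2) = 1" if "c \<le> 2" for c
    proof -
      have "(\<Sum>S\<in>Pow {..<n}. (cmod (X c S))\<^sup>2)
          = (\<Sum>S\<in>Pow {..<n}. (cmod (creation (4*b+c+1) (pair_state b) S))\<^sup>2)"
        unfolding X_def using Suc.prems that z[of c] by (intro norm_creation) (auto simp: creation_def)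
      also have "\<dots> = (\<Sum>S\<in>Pow {..<n}. (cmod (pair_state b S))\<^sup>2)"
        using Suc.prems that z[of "c + 1"] by (intro norm_creation) auto
      finally show ?thesis using Suc by simp
    qed
    have "(cmod (pair_state (Suc b) S))\<^sup>2 = ((cmod (X 0 S))\<^sup>2 + (cmod (X 2 S))\<^sup>2) / 2" for S
    proof -
      have "pair_state (Suc b) S = complex_of_real (1 / sqrt 2) * (X 0 S + X 2 S)"
        by (simp add: X_def numeral_eq_Suc)
      moreover have "X 0 S = 0 \<or> X 2 S = 0" using X0[of 0 S 2] X0[of 2 S 0] by auto
      ultimately show ?thesis
        by (auto simp: norm_mult norm_divide power_mult_distrib power_divide)
    qed
    then have "(\<Sum>S\<in>Pow {..<n}. (cmod (pair_state (Suc b) S))\<^sup>2)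
      = ((\<Sum>S\<in>Pow {..<n}. (cmod (X 0 S))\<^sup>2) + (\<Sum>S\<in>Pow {..<n}. (cmod (X 2 S))\<^sup>2)) / 2"
      by (simp only: sum.distrib sum_divide_distrib[symmetric])
    then show ?case by (simp only: nX) simp
  qed
  also have "(\<Sum>S\<in>Pow {..<n}. (cmod (pair_state m S))\<^sup>2)
      = (\<Sum>S\<in>k_sets n (2 * m). (cmod (pair_state m S))\<^sup>2)"
    using pair_state_eq_0[of _ m] by (intro sum.mono_neutral_right) (auto simp: k_sets_def)
  finally show ?thesis .
qed

section \<open>Two walkers with exclusion on the hypercube\<close>

abbreviation flip :: "nat \<Rightarrow> nat \<Rightarrow> nat" where
  "flip l a \<equiv> xor a (2 ^ l)"

lemma bit_flip: "bit (flip l a) i \<longleftrightarrow> (bit a i \<noteq> (i = l))"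
  by (auto simp: bit_xor_iff bit_exp_iff)

lemma flip_flip: "flip l (flip l a) = a"
  by (rule bit_eqI) (auto simp: bit_flip)

lemma flip_commute: "flip l (flip m a) = flip m (flip l a)"
  by (rule bit_eqI) (auto simp: bit_flip)

lemma flip_neq: "flip l a \<noteq> a"
  by (metis bit_flip)

lemma bit_less_exp:
  fixes a :: nat
  assumes "bit a i" "a < 2 ^ K"
  shows "i < K"
  using assms by (metis bit_take_bit_iff take_bit_nat_eq_self)

lemma less_exp_bitI:
  fixes a :: nat
  assumes "\<And>i. bit a i \<Longrightarrow> i < K"
  shows "a < 2 ^ K"
proof -
  have "take_bit K a = a" by (rule bit_eqI) (use assms in \<open>auto simp: bit_take_bit_iff\<close>)
  then show ?thesis by (simp only: take_bit_nat_eq_self_iff)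
qed

lemma flip_less: "l < K \<Longrightarrow> a < 2 ^ K \<Longrightarrow> flip l a < 2 ^ K"
  by (rule less_exp_bitI) (auto simp: bit_flip dest: bit_less_exp split: if_splits)

lemma sum_flip:
  assumes "l < K"
  shows "(\<Sum>a<2 ^ K. f (flip l a)) = (\<Sum>a<2 ^ K. f a)"
  by (rule sum.reindex_bij_witness[where i="flip l" and j="flip l"])
    (use assms in \<open>auto simp: flip_flip flip_less\<close>)

text \<open>The hypercube is connected: clearing the highest set bit leads from every vertex to
  \<open>0\<close>. The induction runs over a bound \<open>l\<close> on the bit length.\<close>

lemma flip_invariant_const:
  assumes "\<And>l a. l < K \<Longrightarrow> a < 2 ^ K \<Longrightarrow> f (flip l a) = f a" and "a < 2 ^ K"
  shows "f a = f 0"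
proof -
  have "f a = f 0" if "l \<le> K" "a < 2 ^ l" for l a
    using that
  proof (induction l arbitrary: a)
    case 0
    then show ?case by simp
  next
    case (Suc l)
    have aK: "a < 2 ^ K"
      using Suc.prems power_increasing[of "Suc l" K "2::nat"] by simp
    show ?case
    proof (cases "a < 2 ^ l")
      case True
      then show ?thesis using Suc.IH[of a] Suc.prems by simp
    next
      case False
      have "bit a l"
      proof (rule ccontr)
        assume "\<not> bit a l"
        then have "a < 2 ^ l"
          using Suc.prems by (intro less_exp_bitI) (metis bit_less_exp less_SucE)
        then show False using False by simp
      qed
      then have "flip l a < 2 ^ l"
        using Suc.prems by (intro less_exp_bitI) (metis bit_flip bit_less_exp less_SucE)
      then have "f (flip l a) = f 0" using Suc.IH[of "flip l a"] Suc.prems by simp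
      moreover have "f (flip l a) = f a" using assms(1) aK Suc.prems by simp
      ultimately show ?thesis by simp
    qed
  qed
  then show ?thesis using assms(2) by blast
qed

section \<open>Averages of independent walkers\<close>

primrec free_average :: "(nat \<Rightarrow> nat \<Rightarrow> real) \<Rightarrow> nat \<Rightarrow> nat \<Rightarrow> nat \<Rightarrow> real" where
  "free_average P 0 a b = P a b"
| "free_average P (Suc l) a b = (free_average P l a b + free_average P l (flip l a) b
     + free_average P l a (flip l b) + free_average P l (flip l a) (flip l b)) / 4"

lemma free_average_sym:
  assumes "\<And>a b. a < 2 ^ K \<Longrightarrow> b < 2 ^ K \<Longrightarrow> P a b = P b a"
  shows "l \<le> K \<Longrightarrow> a < 2 ^ K \<Longrightarrow> b < 2 ^ K \<Longrightarrow> free_average P l a b = free_average P l b a"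
  by (induction l arbitrary: a b) (auto simp: assms flip_less)

lemma free_average_flip:
  assumes "\<And>a b. a < 2 ^ K \<Longrightarrow> b < 2 ^ K \<Longrightarrow> P (flip N a) b = P a b"
  shows "l \<le> K \<Longrightarrow> a < 2 ^ K \<Longrightarrow> b < 2 ^ K \<Longrightarrow>
    free_average P l (flip N a) b = free_average P l a b"
  by (induction l arbitrary: a b) (auto simp: assms flip_less flip_commute[of _ N])

text \<open>The step for bit \<open>i\<close> averages over flips of that bit and so makes the
  result invariant under them; later steps flip other bits and commute with this symmetry.\<close>

lemma free_average_flip_less:
  assumes "i < l"
  shows "l \<le> K \<Longrightarrow> a < 2 ^ K \<Longrightarrow> b < 2 ^ K \<Longrightarrow>
    free_average P l (flip i a) b = free_average P l a b"
  using assms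
proof (induction l arbitrary: a b)
  case (Suc l)
  show ?case
  proof (cases "i = l")
    case True
    then show ?thesis by (simp add: flip_flip)
  next
    case False
    then have "flip l (flip i a) = flip i (flip l a)" by (intro flip_commute)
    then show ?thesis using Suc False by (simp add: flip_less)
  qed
qed simp

lemma sum_free_average:
  "l \<le> K \<Longrightarrow> (\<Sum>a<2 ^ K. \<Sum>b<2 ^ K. free_average P l a b) = (\<Sum>a<2 ^ K. \<Sum>b<2 ^ K. P a b)"
proof (induction l)
  case (Suc l)
  have 1: "(\<Sum>a<2 ^ K. \<Sum>b<2 ^ K. free_average P l (flip l a) b) = (\<Sum>a<2 ^ K. \<Sum>b<2 ^ K. free_average P l a b)"
    using Suc.prems by (intro sum_flip[where f="\<lambda>a. \<Sum>b<2 ^ K. free_average P l a b"]) simp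
  have 2: "(\<Sum>b<2 ^ K. free_average P l a (flip l b)) = (\<Sum>b<2 ^ K. free_average P l a b)" for a
    using Suc.prems by (intro sum_flip) simp
  have "(\<Sum>a<2 ^ K. \<Sum>b<2 ^ K. free_average P l (flip l a) (flip l b))
      = (\<Sum>a<2 ^ K. \<Sum>b<2 ^ K. free_average P l a b)"
    unfolding 2 by (rule 1)
  with 1 Suc show ?case
    by (simp only: free_average.simps sum_divide_distrib[symmetric] sum.distrib 2) simp
qed simp

text \<open>\<open>q\<close> evolves like a pair of walkers that flip bit \<open>l\<close> of their positions independently, except
  that a pair of partners stays put; \<open>free_average\<close> is the evolution without this exclusion.  Their
  difference, summed over all positions, telescopes in \<open>m\<close>.\<close>

context
  fixes q :: "nat \<Rightarrow> nat \<Rightarrow> nat \<Rightarrow> real" and P :: "nat \<Rightarrow> nat \<Rightarrow> real" and K N :: nat and s :: real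
  assumes K: "K = Suc N"
    and q_0: "\<And>a b. a < 2 ^ K \<Longrightarrow> b < 2 ^ K \<Longrightarrow> q 0 a b = P a b"
    and q_flip: "\<And>l a. l < K \<Longrightarrow> a < 2 ^ K \<Longrightarrow> q (Suc l) a (flip l a) = q l a (flip l a)"
    and q_average: "\<And>l a b. \<lbrakk>l < K; a < 2 ^ K; b < 2 ^ K; a \<noteq> b; b \<noteq> flip l a\<rbrakk> \<Longrightarrow>
        q (Suc l) a b = (q l a b + q l (flip l a) b + q l a (flip l b) + q l (flip l a) (flip l b)) / 4"
    and P_diag: "\<And>a. a < 2 ^ K \<Longrightarrow> P a a = 0"
    and P_sym: "\<And>a b. a < 2 ^ K \<Longrightarrow> b < 2 ^ K \<Longrightarrow> P a b = P b a"
    and P_flip: "\<And>a b. a < 2 ^ K \<Longrightarrow> b < 2 ^ K \<Longrightarrow> P (flip N a) b = P a b"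
    and P_sum: "(\<Sum>a<2 ^ K. \<Sum>b<2 ^ K. P a b) = s" "s \<ge> 0"
begin

abbreviation "free \<equiv> free_average P"

abbreviation "diagonal_sum m \<equiv> (\<Sum>a<2 ^ K. free m a a)"

text \<open>Exclusion in the step for bit \<open>l\<close> touches only pairs that differ in that
  bit alone. A pair that differs in a bit not yet treated has the same difference in all its
  predecessors, so none of them was ever a pair of partners.\<close>

lemma exclusion_eq_free:
  "\<lbrakk>l \<le> K; a < 2 ^ K; b < 2 ^ K; i \<ge> l; bit a i \<noteq> bit b i\<rbrakk> \<Longrightarrow> q l a b = free l a b"
proof (induction l arbitrary: a b)
  case 0
  then show ?case by (simp add: q_0)
next
  case (Suc l)
  have "a \<noteq> b" using Suc.prems by auto
  moreover have "b \<noteq> flip l a" using Suc.prems by (auto simp: bit_flip)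
  ultimately have "q (Suc l) a b
      = (q l a b + q l (flip l a) b + q l a (flip l b) + q l (flip l a) (flip l b)) / 4"
    using Suc.prems by (intro q_average) auto
  also have "\<dots> = free (Suc l) a b"
    using Suc by (simp add: flip_less bit_flip)
  finally show ?case .
qed

text \<open>The defect of pairs at distance \<open>flip m\<close> is created in layer
  \<open>Suc m\<close>, where such pairs are frozen. Afterwards only moves of both walkers or of
  neither keep them at this distance, which is half of the moves, so each further layer halves the
  total defect; the power of 2 compensates.\<close>

lemma sum_exclusion_defect:
  assumes "m < N" "Suc m \<le> l" "l \<le> N"
  shows "2 ^ (l - Suc m) * (\<Sum>a<2 ^ K. q l a (flip m a) - free l a (flip m a)) = diagonal_sum (Suc m) - diagonal_sum m"
  using assms(2,3)
proof (induction l rule: dec_induct)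
  case base
  have mK: "m < K" using assms K by simp
  have 1: "q (Suc m) a (flip m a) = free m a (flip m a)" if "a < 2 ^ K" for a
    using that mK exclusion_eq_free[of m a "flip m a" m]
    by (simp add: q_flip flip_less bit_flip)
  define X where "X = (\<Sum>a<2 ^ K. free m a (flip m a))"
  have X2: "(\<Sum>a<2 ^ K. free m (flip m a) a) = X"
    using sum_flip[OF mK, of "\<lambda>a. free m a (flip m a)"] by (simp add: X_def flip_flip)
  have T2: "(\<Sum>a<2 ^ K. free m (flip m a) (flip m a)) = diagonal_sum m"
    by (rule sum_flip[OF mK])
  have "(\<Sum>a<2 ^ K. q (Suc m) a (flip m a) - free (Suc m) a (flip m a))
      = (\<Sum>a<2 ^ K. free m a (flip m a) - free (Suc m) a (flip m a))"
    by (intro sum.cong) (auto simp: 1)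
  also have "\<dots> = X - (2 * X + 2 * diagonal_sum m) / 4"
    by (simp add: sum_subtractf sum_divide_distrib[symmetric] sum.distrib flip_flip X2 T2 X_def[symmetric])
  finally have D: "(\<Sum>a<2 ^ K. q (Suc m) a (flip m a) - free (Suc m) a (flip m a))
      = X - (2 * X + 2 * diagonal_sum m) / 4" .
  \<comment> \<open>Right after this layer the free diagonal and the free partner pairs carry the
    same mass, the mean of \<open>X\<close> and \<open>diagonal_sum m\<close>. Hence
    \<open>X\<close> exceeds it by as much as it exceeds the old diagonal mass.\<close>
  have "diagonal_sum (Suc m) = (2 * X + 2 * diagonal_sum m) / 4"
    by (simp add: sum_divide_distrib[symmetric] sum.distrib X2 T2 X_def[symmetric])
  moreover have "X - (2 * X + 2 * t) / 4 = (2 * X + 2 * t) / 4 - t" for t :: real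
    by (simp add: field_simps)
  ultimately show ?case using D by (simp only: diff_self_eq_0 power_0 mult_1_left)
next
  case (step l)
  have lK: "l < K" using step K by simp
  define D where "D a = q l a (flip m a) - free l a (flip m a)" for a
  have "q (Suc l) a (flip m a) - free (Suc l) a (flip m a) = (D a + D (flip l a)) / 4"
    if a: "a < 2 ^ K" for a
  proof -
    have mK: "m < K" using assms K by simp
    have "m \<noteq> l" using step by simp
    have "q (Suc l) a (flip m a) = (q l a (flip m a) + q l (flip l a) (flip m a)
        + q l a (flip l (flip m a)) + q l (flip l a) (flip l (flip m a))) / 4"
    proof (rule q_average[OF lK a flip_less[OF mK a]])
      show "a \<noteq> flip m a" using flip_neq by metis
      show "flip m a \<noteq> flip l a" using \<open>m \<noteq> l\<close> by (metis bit_flip)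
    qed
    \<comment> \<open>If only one walker moves, the positions differ in the still untreated bit
      \<open>l\<close>, so these terms are free and contribute no defect.\<close>
    moreover have "q l (flip l a) (flip m a) = free l (flip l a) (flip m a)"
      using \<open>m \<noteq> l\<close> a lK mK by (intro exclusion_eq_free[of l _ _ l]) (auto simp: bit_flip flip_less)
    moreover have "q l a (flip l (flip m a)) = free l a (flip l (flip m a))"
      using \<open>m \<noteq> l\<close> a lK mK by (intro exclusion_eq_free[of l _ _ l]) (auto simp: bit_flip flip_less)
    moreover have "D (flip l a) = q l (flip l a) (flip l (flip m a)) - free l (flip l a) (flip l (flip m a))"
      unfolding D_def by (metis flip_commute)
    ultimately show ?thesis by (simp add: D_def field_simps)
  qed
  then have "(\<Sum>a<2 ^ K. q (Suc l) a (flip m a) - free (Suc l) a (flip m a))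
      = (\<Sum>a<2 ^ K. (D a + D (flip l a)) / 4)"
    by (intro sum.cong) auto
  also have "\<dots> = (\<Sum>a<2 ^ K. D a) / 2"
    by (simp add: sum_divide_distrib[symmetric] sum.distrib sum_flip[OF lK])
  finally have E: "(\<Sum>a<2 ^ K. q (Suc l) a (flip m a) - free (Suc l) a (flip m a)) = (\<Sum>a<2 ^ K. D a) / 2" .
  have p: "(2::real) ^ (Suc l - Suc m) = 2 * 2 ^ (l - Suc m)"
    using step.hyps by (simp flip: power_Suc add: Suc_diff_Suc)
  have "2 ^ (l - Suc m) * (\<Sum>a<2 ^ K. D a) = diagonal_sum (Suc m) - diagonal_sum m"
    using step.IH step.prems by (simp add: D_def del: free_average.simps)
  then show ?case unfolding E p by (simp del: free_average.simps)
qed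

text \<open>The first \<open>N\<close> layers average over the bits below \<open>N\<close>;
  invariance in the top bit is inherited from \<open>P\<close>. Together these are all flips of the
  first argument, and symmetry transfers the result to the second.\<close>

lemma free_average_const:
  assumes "a < 2 ^ K" "b < 2 ^ K"
  shows "free N a b = free N 0 0"
proof -
  have inv: "free N (flip l a) b = free N a b" if "l < K" "a < 2 ^ K" "b < 2 ^ K" for l a b
  proof (cases "l = N")
    case True
    then show ?thesis using that free_average_flip[where K=K and N=N and P=P, OF P_flip, of N a b] K by simp
  next
    case False
    then show ?thesis using that K by (intro free_average_flip_less[where K=K]) auto
  qed
  have sym: "free N a b = free N b a" if "a < 2 ^ K" "b < 2 ^ K" for a b
    using free_average_sym[where K=K and P=P, OF P_sym] that K by simp
  have "free N a b = free N 0 b"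
    using inv assms by (intro flip_invariant_const[where f="\<lambda>a. free N a b" and K=K]) auto
  also have "\<dots> = free N b 0" using sym assms by simp
  also have "\<dots> = free N 0 0"
    using inv assms by (intro flip_invariant_const[where f="\<lambda>a. free N a 0" and K=K]) auto
  finally show ?thesis .
qed

text \<open>Two pigeonhole arguments, first over the layer \<open>m\<close> and then over the
  position \<open>a\<close>, applied to the telescoped growth of the free diagonal mass from 0 to
  its uniform value.\<close>

lemma exists_large_defect:
  assumes "N \<ge> 1"
  shows "\<exists>a m. a < 2 ^ K \<and> m < N \<and> 4 * s / (2 ^ K) ^ 3
    \<le> q N a (flip m a) + q N (flip N a) (flip N (flip m a))
      - q N (flip N a) (flip m a) - q N a (flip N (flip m a))"
proof -
  define D where "D m a = q N a (flip m a) - free N a (flip m a)" for m a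
  define n :: real where "n = 2 ^ K"
  have n: "n > 0" "n = 2 * 2 ^ N" by (simp_all add: n_def K)
  define r where "r = free N 0 0"
  have R: "free N a b = r" if "a < 2 ^ K" "b < 2 ^ K" for a b
    unfolding r_def using that by (rule free_average_const)
  have "(\<Sum>a<2 ^ K. \<Sum>b<2 ^ K. free N a b) = s"
    using sum_free_average[of N K P] P_sum K by simp
  moreover have "(\<Sum>a<2 ^ K. \<Sum>b<2 ^ K. free N a b) = (\<Sum>a<(2::nat) ^ K. \<Sum>b<(2::nat) ^ K. r)"
    by (intro sum.cong refl R) auto
  moreover have "diagonal_sum N = (\<Sum>a<(2::nat) ^ K. r)"
    by (intro sum.cong refl R) auto
  ultimately have TN: "diagonal_sum N = s / n" using n by (simp add: n_def field_simps)
  have "diagonal_sum 0 = 0" by (simp add: P_diag)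
  have "s / n = (\<Sum>m<N. diagonal_sum (Suc m) - diagonal_sum m)"
    using TN \<open>diagonal_sum 0 = 0\<close> sum_lessThan_telescope[of "\<lambda>m. diagonal_sum m" N] by (simp only: diff_0_right)
  also have "\<dots> = (\<Sum>m<N. 2 ^ (N - Suc m) * (\<Sum>a<2 ^ K. D m a))"
    using sum_exclusion_defect[of _ N] by (intro sum.cong) (auto simp: D_def)
  finally have sn: "s / n = (\<Sum>m<N. 2 ^ (N - Suc m) * (\<Sum>a<2 ^ K. D m a))" .
  \<comment> \<open>The weights sum to \<open>2 ^ N - 1\<close>, which is below
    \<open>n / 2\<close>; if every total defect stayed under this threshold, the weighted sum could
    not reach \<open>s / n\<close>.\<close>
  have "\<exists>m<N. 2 * s / n ^ 2 \<le> (\<Sum>a<2 ^ K. D m a)"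
  proof (rule ccontr)
    assume "\<not> ?thesis"
    then have small: "(\<Sum>a<2 ^ K. D m a) < 2 * s / n ^ 2" if "m < N" for m using that by force
    have "{..<N} \<noteq> {}" using assms by (simp add: lessThan_empty_iff)
    then have "s / n < (\<Sum>m<N. 2 ^ (N - Suc m) * (2 * s / n ^ 2))"
      unfolding sn by (intro sum_strict_mono mult_strict_left_mono small) simp_all
    also have "\<dots> = (\<Sum>m<N. 2 ^ (N - Suc m)) * (2 * s / n ^ 2)"
      by (rule sum_distrib_right[symmetric])
    also have "(\<Sum>m<N. 2 ^ (N - Suc m)) = (\<Sum>m<N. (2::real) ^ m)"
      by (rule sum.nat_diff_reindex)
    also have "\<dots> = 2 ^ N - 1" by (simp add: geometric_sum)
    also have "(2 ^ N - 1) * (2 * s / n ^ 2) \<le> 2 ^ N * (2 * s / n ^ 2)"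
      using P_sum(2) by (intro mult_right_mono) auto
    also have "\<dots> = s / n" using n by (simp add: power2_eq_square field_simps)
    finally show False by simp
  qed
  then obtain m where m: "m < N" "2 * s / n ^ 2 \<le> (\<Sum>a<2 ^ K. D m a)" by blast
  \<comment> \<open>Adding the defect at \<open>flip N a\<close> doubles the sum over
    \<open>a\<close>; the resulting \<open>4 * s / n ^ 2\<close> is shared by \<open>n\<close>
    positions.\<close>
  have "\<exists>a<2 ^ K. 4 * s / n ^ 3 \<le> D m a + D m (flip N a)"
  proof (rule ccontr)
    assume "\<not> ?thesis"
    then have "D m a + D m (flip N a) < 4 * s / n ^ 3" if "a < 2 ^ K" for a
      using that not_le by blast
    moreover have "{..<(2::nat) ^ K} \<noteq> {}" by (simp add: lessThan_empty_iff)
    ultimately have "(\<Sum>a<2 ^ K. D m a + D m (flip N a)) < (\<Sum>a<(2::nat) ^ K. 4 * s / n ^ 3)"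
      by (intro sum_strict_mono) simp_all
    also have "\<dots> = 4 * s / n ^ 2" using n by (simp add: n_def power3_eq_cube power2_eq_square)
    also have "(\<Sum>a<2 ^ K. D m a + D m (flip N a)) = 2 * (\<Sum>a<2 ^ K. D m a)"
      using sum_flip[of N K "D m"] K by (simp only: sum.distrib lessI)
    finally show False using m by simp
  qed
  then obtain a where a: "a < 2 ^ K" "4 * s / n ^ 3 \<le> D m a + D m (flip N a)" by blast
  have NK: "N < K" "m < K" "N \<noteq> m" using K m by auto
  have "q N (flip N a) (flip m a) = free N (flip N a) (flip m a)"
    using a NK by (intro exclusion_eq_free[of N _ _ N]) (auto simp: bit_flip flip_less)
  moreover have "q N a (flip N (flip m a)) = free N a (flip N (flip m a))"
    using a NK by (intro exclusion_eq_free[of N _ _ N]) (auto simp: bit_flip flip_less)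
  moreover have D': "D m (flip N a) = q N (flip N a) (flip N (flip m a)) - free N (flip N a) (flip N (flip m a))"
    unfolding D_def by (metis flip_commute)
  \<comment> \<open>The two mixed pairs are free, so all four free values equal \<open>r\<close> and
    cancel.\<close>
  ultimately have "D m a + D m (flip N a) = q N a (flip m a) + q N (flip N a) (flip N (flip m a))
      - q N (flip N a) (flip m a) - q N a (flip N (flip m a))"
    using a NK by (simp add: D' D_def[of m a] R flip_less)
  then show ?thesis using a m unfolding n_def by metis
qed
end

section \<open>The encoded state and the rows of the butterfly\<close>

lemma index_mult_mat_sum:
  fixes A B :: "complex mat"
  assumes "i < dim_row A" "p < dim_col B" "dim_col A = dim_row B"
  shows "(A * B) $$ (i, p) = (\<Sum>j<dim_col A. A $$ (i, j) * B $$ (j, p))"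
  using assms by (simp add: scalar_prod_def atLeast0LessThan)

lemma norm_preserving_mult:
  assumes "norm_preserving A" "norm_preserving B" "dim_col A = dim_row B"
  shows "norm_preserving (A * B)"
  unfolding norm_preserving_def
proof
  fix z
  have "(\<Sum>i<dim_row (A * B). (cmod (\<Sum>p<dim_col (A * B). (A * B) $$ (i, p) * z p))\<^sup>2)
      = (\<Sum>i<dim_row A. (cmod (\<Sum>j<dim_col A. A $$ (i, j) * (\<Sum>p<dim_col B. B $$ (j, p) * z p)))\<^sup>2)"
  proof (intro sum.cong refl)
    fix i assume "i \<in> {..<dim_row A}"
    then have "(\<Sum>p<dim_col (A * B). (A * B) $$ (i, p) * z p)
        = (\<Sum>p<dim_col B. \<Sum>j<dim_col A. A $$ (i, j) * B $$ (j, p) * z p)"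
      using assms(3) by (intro sum.cong) (auto simp: index_mult_mat_sum sum_distrib_right
        simp del: index_mult_mat(1))
    also have "\<dots> = (\<Sum>j<dim_col A. A $$ (i, j) * (\<Sum>p<dim_col B. B $$ (j, p) * z p))"
      by (subst sum.swap) (simp add: sum_distrib_left mult.assoc)
    finally show "(cmod (\<Sum>p<dim_col (A * B). (A * B) $$ (i, p) * z p))\<^sup>2
        = (cmod (\<Sum>j<dim_col A. A $$ (i, j) * (\<Sum>p<dim_col B. B $$ (j, p) * z p)))\<^sup>2" by simp
  qed simp
  also have "\<dots> = (\<Sum>j<dim_col A. (cmod (\<Sum>p<dim_col B. B $$ (j, p) * z p))\<^sup>2)"
    using assms(1) by (simp add: norm_preserving_def)
  also have "\<dots> = (\<Sum>p<dim_col (A * B). (cmod (z p))\<^sup>2)"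
    using assms(2,3) by (simp add: norm_preserving_def)
  finally show "(\<Sum>i<dim_row (A * B). (cmod (\<Sum>p<dim_col (A * B). (A * B) $$ (i, p) * z p))\<^sup>2)
      = (\<Sum>p<dim_col (A * B). (cmod (z p))\<^sup>2)" .
qed

lemma norm_preserving_orthonormal:
  assumes "\<And>r s. r < dim_col U \<Longrightarrow> s < dim_col U \<Longrightarrow>
    (\<Sum>i<dim_row U. U $$ (i, r) * cnj (U $$ (i, s))) = (if r = s then 1 else 0)"
  shows "norm_preserving U"
  unfolding norm_preserving_def
proof
  fix z
  have "complex_of_real (\<Sum>i<dim_row U. (cmod (\<Sum>p<dim_col U. U $$ (i, p) * z p))\<^sup>2)
      = (\<Sum>i<dim_row U. \<Sum>r<dim_col U. \<Sum>s<dim_col U.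
          z r * cnj (z s) * (U $$ (i, r) * cnj (U $$ (i, s))))"
    by (simp add: complex_norm_square sum_product mult_ac del: of_real_power)
  also have "\<dots> = (\<Sum>r<dim_col U. \<Sum>s<dim_col U.
          z r * cnj (z s) * (\<Sum>i<dim_row U. U $$ (i, r) * cnj (U $$ (i, s))))"
    unfolding sum_distrib_left
    by (rule trans[OF sum.swap], rule sum.cong[OF refl], rule sum.swap)
  also have "\<dots> = (\<Sum>r<dim_col U. \<Sum>s<dim_col U. if r = s then z r * cnj (z s) else 0)"
    using assms by (intro sum.cong refl) auto
  also have "\<dots> = complex_of_real (\<Sum>p<dim_col U. (cmod (z p))\<^sup>2)"
    by (simp add: complex_norm_square del: of_real_power)
  finally show "(\<Sum>i<dim_row U. (cmod (\<Sum>p<dim_col U. U $$ (i, p) * z p))\<^sup>2)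
      = (\<Sum>p<dim_col U. (cmod (z p))\<^sup>2)"
    by (simp only: of_real_eq_iff)
qed

text \<open>The Hadamard sign as a product over bits, so that flipping one bit of an argument
  changes a single factor.\<close>

definition walsh :: "nat \<Rightarrow> nat \<Rightarrow> nat \<Rightarrow> complex" where
  "walsh K p q = (\<Prod>l<K. if bit p l \<and> bit q l then -1 else 1)"

lemma walsh_eq: "walsh K p q = (-1) ^ card {l. l < K \<and> bit p l \<and> bit q l}"
proof -
  have "{l. l < K \<and> bit p l \<and> bit q l} = {l \<in> {..<K}. bit p l \<and> bit q l}" by auto
  then show ?thesis
    by (simp add: walsh_def prod.inter_filter[symmetric] del: mem_Collect_eq)
qed

lemma cnj_walsh: "cnj (walsh K p q) = walsh K p q"
  by (simp add: walsh_eq)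

lemma walsh_square: "walsh K p q * walsh K p q = 1"
  by (simp add: walsh_eq power_mult_distrib[symmetric])

lemma walsh_flip:
  assumes "l < K"
  shows "walsh K (flip l p) q = (if bit q l then -1 else 1) * walsh K p q"
proof -
  let ?f = "\<lambda>p l. if bit p l \<and> bit q l then -1 else (1::complex)"
  have s: "walsh K p q = ?f p l * prod (?f p) ({..<K} - {l})" for p
    unfolding walsh_def using assms by (intro prod.remove) auto
  have "prod (?f (flip l p)) ({..<K} - {l}) = prod (?f p) ({..<K} - {l})"
    by (intro prod.cong refl) (auto simp: bit_flip)
  then show ?thesis unfolding s by (auto simp: bit_flip)
qed

text \<open>Flipping a bit in which \<open>r\<close> and \<open>s\<close> differ permutes the
  summation range and reverses every sign, so the sum equals its own negative.\<close>

lemma walsh_orthogonal: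
  assumes "r < 2 ^ K" "s < 2 ^ K" "r \<noteq> s"
  shows "(\<Sum>p<2 ^ K. walsh K p r * walsh K p s) = 0"
proof -
  obtain l where l: "bit r l \<noteq> bit s l" using assms(3) bit_eq_iff by blast
  have "l < K"
    using l assms bit_less_exp by metis
  have "(\<Sum>p<2 ^ K. walsh K p r * walsh K p s) = (\<Sum>p<2 ^ K. walsh K (flip l p) r * walsh K (flip l p) s)"
    by (rule sum_flip[OF \<open>l < K\<close>, symmetric])
  also have "\<dots> = - (\<Sum>p<2 ^ K. walsh K p r * walsh K p s)"
    using l by (auto simp: walsh_flip[OF \<open>l < K\<close>] sum_negf)
  finally show ?thesis by simp
qed

lemma hadamard_index:
  "p < 2 ^ K \<Longrightarrow> q < 2 ^ K \<Longrightarrow> hadamard K $$ (p, q) = walsh K p q / complex_of_real (sqrt (2 ^ K))"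
  by (simp add: hadamard_def walsh_eq)

lemma dim_hadamard: "dim_row (hadamard K) = 2 ^ K" "dim_col (hadamard K) = 2 ^ K"
  by (simp_all add: hadamard_def)

lemma norm_preserving_hadamard: "norm_preserving (hadamard K)"
proof (rule norm_preserving_orthonormal)
  fix r s assume "r < dim_col (hadamard K)" "s < dim_col (hadamard K)"
  then have rs: "r < 2 ^ K" "s < 2 ^ K" by (simp_all add: dim_hadamard)
  have sq: "complex_of_real (sqrt (2 ^ K)) * complex_of_real (sqrt (2 ^ K)) = 2 ^ K"
    by (simp flip: of_real_mult)
  have "(\<Sum>i<dim_row (hadamard K). hadamard K $$ (i, r) * cnj (hadamard K $$ (i, s)))
      = (\<Sum>i<2 ^ K. walsh K i r * walsh K i s) / 2 ^ K"
    using rs unfolding dim_hadamard sum_divide_distrib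
    by (intro sum.cong refl) (simp add: hadamard_index cnj_walsh sq)
  also have "\<dots> = (if r = s then 1 else 0)"
    using walsh_orthogonal[OF rs] by (simp add: walsh_square)
  finally show "(\<Sum>i<dim_row (hadamard K). hadamard K $$ (i, r) * cnj (hadamard K $$ (i, s)))
      = (if r = s then 1 else 0)" .
qed

lemma dim_phase_diag: "dim_row (phase_diag n \<phi>) = n" "dim_col (phase_diag n \<phi>) = n"
  by (simp_all add: phase_diag_def mat_diag_def)

lemma phase_diag_index:
  "i < n \<Longrightarrow> j < n \<Longrightarrow> phase_diag n \<phi> $$ (i, j) = (if i = j then cis (- \<phi> j) else 0)"
  by (auto simp: phase_diag_def mat_diag_def cis_conv_exp)

lemma sum_phase_diag:
  assumes "i < n"
  shows "(\<Sum>p<n. phase_diag n \<phi> $$ (i, p) * z p) = cis (- \<phi> i) * z i"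
proof -
  have "(\<Sum>p<n. phase_diag n \<phi> $$ (i, p) * z p) = (\<Sum>p<n. if i = p then cis (- \<phi> i) * z i else 0)"
    using assms by (intro sum.cong) (auto simp: phase_diag_index)
  then show ?thesis using assms by simp
qed

lemma norm_preserving_phase_diag: "norm_preserving (phase_diag n \<phi>)"
  by (simp add: norm_preserving_def dim_phase_diag sum_phase_diag norm_mult)

lemma norm_encoded_state:
  assumes "4 * m \<le> 2 ^ K"
  shows "(\<Sum>S\<in>k_sets (2 ^ K) (2 * m). (cmod (encoded_state K (2 * m) \<phi> S))\<^sup>2) = 1"
proof -
  let ?V = "phase_diag (2 ^ K) \<phi> * hadamard K"
  have "norm_preserving ?V"
    by (intro norm_preserving_mult norm_preserving_phase_diag norm_preserving_hadamard)
      (simp add: dim_phase_diag dim_hadamard)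
  from norm_ext_power[OF this, of "2 * m" "pair_state m"] show ?thesis
    by (simp add: encoded_state_def dim_phase_diag dim_hadamard norm_pair_state[OF assms])
qed

text \<open>The input occupies only the lower half of the modes, on which the rows \<open>p\<close> and
  \<open>flip N p\<close> of the Hadamard matrix agree.\<close>

lemma annihilation_encoded_flip:
  assumes "4 * Suc m \<le> 2 ^ N" "p < 2 ^ Suc N"
  shows "annihilation (flip N p) (encoded_state (Suc N) (2 * Suc m) \<phi>)
    = (\<lambda>S. cis (\<phi> p - \<phi> (flip N p)) * annihilation p (encoded_state (Suc N) (2 * Suc m) \<phi>) S)"
proof
  fix S
  let ?K = "Suc N" and ?\<Psi> = "pair_state (Suc m)"
  let ?V = "phase_diag (2 ^ ?K) \<phi> * hadamard ?K"
  have ann: "annihilation p (encoded_state ?K (2 * Suc m) \<phi>) S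
      = ext_power (2 * m + 1) ?V (annihilate_row ?V p ?\<Psi>) S" if "p < 2 ^ ?K" for p
    using annihilation_ext_power[of p ?V "2 * m + 1" ?\<Psi> S] that
    by (simp add: encoded_state_def dim_phase_diag)
  have V: "?V $$ (p, r) = cis (- \<phi> p) * walsh ?K p r / complex_of_real (sqrt (2 ^ ?K))"
    if "p < 2 ^ ?K" "r < 2 ^ ?K" for p r
    using that
    by (subst index_mult_mat_sum)
      (simp_all only: dim_phase_diag dim_hadamard sum_phase_diag hadamard_index times_divide_eq_right)
  have fp: "flip N p < 2 ^ ?K" using assms by (intro flip_less) auto
  have "annihilate_row ?V (flip N p) ?\<Psi> T = cis (\<phi> p - \<phi> (flip N p)) * annihilate_row ?V p ?\<Psi> T" for T
  proof -
    have "?V $$ (flip N p, r) * annihilation r ?\<Psi> T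
      = cis (\<phi> p - \<phi> (flip N p)) * (?V $$ (p, r) * annihilation r ?\<Psi> T)" if "r < 2 ^ ?K" for r
    proof (cases "r < 2 ^ N")
      case True
      then have "\<not> bit r N" using bit_less_exp by blast
      then have "walsh ?K (flip N p) r = walsh ?K p r" by (simp add: walsh_flip)
      moreover have "cis (\<phi> p - \<phi> (flip N p)) * cis (- \<phi> p) = cis (- \<phi> (flip N p))"
        by (simp add: cis_mult)
      ultimately show ?thesis
        unfolding V[OF fp that] V[OF assms(2) that] by (simp add: mult.assoc[symmetric])
    next
      case False
      \<comment> \<open>The input lives on the lowest \<open>4 * Suc m\<close> modes, all of them
        below \<open>2 ^ N\<close>, so mode \<open>r\<close> is empty.\<close>
      then have "?\<Psi> (insert r T) = 0"
        using assms(1) by (intro pair_state_eq_0) (auto simp: k_sets_def)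
      then show ?thesis by (simp add: annihilation_def)
    qed
    then show ?thesis
      unfolding annihilate_row_def sum_distrib_left by (intro sum.cong refl) (simp add: dim_hadamard)
  qed
  then have "annihilate_row ?V (flip N p) ?\<Psi> = (\<lambda>T. cis (\<phi> p - \<phi> (flip N p)) * annihilate_row ?V p ?\<Psi> T)"
    by auto
  then show "annihilation (flip N p) (encoded_state ?K (2 * Suc m) \<phi>) S
      = cis (\<phi> p - \<phi> (flip N p)) * annihilation p (encoded_state ?K (2 * Suc m) \<phi>) S"
    using assms(2) fp by (simp only: ann) (simp add: ext_power_def sum_distrib_left mult_ac)
qed

section \<open>Rows of the butterfly layers\<close>

lemma partner_Suc: "partner (Suc l) a = flip l a"
  by (simp add: partner_def)

lemma dim_butterfly_layer: "dim_row (butterfly_layer K l \<omega>) = 2 ^ K" "dim_col (butterfly_layer K l \<omega>) = 2 ^ K"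
  by (simp_all add: butterfly_layer_def rbs_layer_def dim_phase_diag)

lemma dim_butterfly_upto: "dim_row (butterfly_upto K \<omega> l) = 2 ^ K" "dim_col (butterfly_upto K \<omega> l) = 2 ^ K"
  by (induction l) (simp_all add: dim_butterfly_layer)

text \<open>Layers are numbered from 1 and bits from 0: bit \<open>l\<close> is flipped by layer
  \<open>Suc l\<close>.\<close>

abbreviation pair_angle :: "nat \<Rightarrow> nat \<Rightarrow> angle" where
  "pair_angle l a \<equiv> RBS (Suc l) (min a (flip l a))"

lemma sum_butterfly_layer:
  fixes \<omega> :: "angle \<Rightarrow> real"
  assumes l: "l < K" and i: "i < 2 ^ K"
  defines "\<theta> \<equiv> \<omega> (pair_angle l i)"
  shows "(\<Sum>p<2 ^ K. butterfly_layer K (Suc l) \<omega> $$ (i, p) * z p)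
    = complex_of_real (cos \<theta>) * (cis (- \<omega> (Phase (Suc l) i)) * z i)
      + complex_of_real (sin \<theta>) * ((if i < flip l i then -1 else 1)
          * cis (- \<omega> (Phase (Suc l) (flip l i))) * z (flip l i))"
proof -
  let ?n = "2 ^ K" and ?i = "flip l i"
  let ?D = "phase_diag ?n (\<lambda>j. \<omega> (Phase (Suc l) j))" and ?R = "rbs_layer K (Suc l) \<omega>"
  have i': "?i < ?n" using flip_less[OF l i] .
  have R: "?R $$ (i, q) = (if q = i then complex_of_real (cos \<theta>) else 0)
      + (if q = ?i then complex_of_real (if i < ?i then - sin \<theta> else sin \<theta>) else 0)" if "q < ?n" for q
    using that i flip_neq[of i l] by (simp add: rbs_layer_def partner_Suc \<theta>_def Let_def)
  have "(\<Sum>p<?n. butterfly_layer K (Suc l) \<omega> $$ (i, p) * z p)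
      = (\<Sum>p<?n. \<Sum>j<?n. ?R $$ (i, j) * ?D $$ (j, p) * z p)"
    using i by (intro sum.cong refl)
      (auto simp: butterfly_layer_def index_mult_mat_sum rbs_layer_def dim_phase_diag sum_distrib_right
        simp del: index_mult_mat(1) index_mat(1))
  also have "\<dots> = (\<Sum>j<?n. ?R $$ (i, j) * (\<Sum>p<?n. ?D $$ (j, p) * z p))"
    by (subst sum.swap) (simp add: sum_distrib_left mult.assoc)
  also have "\<dots> = (\<Sum>j<?n. ((if j = i then complex_of_real (cos \<theta>) else 0)
      + (if j = ?i then complex_of_real (if i < ?i then - sin \<theta> else sin \<theta>) else 0))
      * (cis (- \<omega> (Phase (Suc l) j)) * z j))"
    by (intro sum.cong refl) (simp add: R sum_phase_diag)
  also have "\<dots> = complex_of_real (cos \<theta>) * (cis (- \<omega> (Phase (Suc l) i)) * z i)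
      + complex_of_real (if i < ?i then - sin \<theta> else sin \<theta>) * (cis (- \<omega> (Phase (Suc l) ?i)) * z ?i)"
    using i i' by (simp add: distrib_right sum.distrib if_distrib[of "\<lambda>x. x * _"] cong: if_cong)
  finally show ?thesis by (auto simp: mult.assoc)
qed

lemma cmod_rotation:
  "(cmod (complex_of_real (cos t) * x + complex_of_real (sin t) * (- 1 * y)))\<^sup>2
    + (cmod (complex_of_real (cos t) * y + complex_of_real (sin t) * x))\<^sup>2
    = (cmod x)\<^sup>2 + (cmod y)\<^sup>2"
proof -
  have "(c * a + s * (- b))\<^sup>2 + (c * a' + s * (- b'))\<^sup>2 + ((c * b + s * a)\<^sup>2 + (c * b' + s * a')\<^sup>2)
      = (c\<^sup>2 + s\<^sup>2) * ((a\<^sup>2 + a'\<^sup>2) + (b\<^sup>2 + b'\<^sup>2))" for c s a b a' b' :: real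
    by (simp add: power2_eq_square algebra_simps)
  from this[of "cos t" "Re x" "sin t" "Re y" "Im x" "Im y"] show ?thesis
    by (simp add: cmod_power2)
qed

text \<open>Each rotation preserves the norm on its pair. Summing the pairwise identity over all
  \<open>i\<close> counts every pair twice on both sides, which avoids choosing
  representatives.\<close>

lemma norm_preserving_butterfly_layer:
  assumes "l < K"
  shows "norm_preserving (butterfly_layer K (Suc l) \<omega>)"
  unfolding norm_preserving_def dim_butterfly_layer
proof
  fix z
  let ?e = "\<lambda>i. cis (- \<omega> (Phase (Suc l) i)) * z i"
  define y where "y i = (\<Sum>p<2 ^ K. butterfly_layer K (Suc l) \<omega> $$ (i, p) * z p)" for i
  have "(cmod (y i))\<^sup>2 + (cmod (y (flip l i)))\<^sup>2 = (cmod (z i))\<^sup>2 + (cmod (z (flip l i)))\<^sup>2"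
    if "i < 2 ^ K" for i
  proof -
    have lt: "(cmod (y i))\<^sup>2 + (cmod (y (flip l i)))\<^sup>2 = (cmod (z i))\<^sup>2 + (cmod (z (flip l i)))\<^sup>2"
      if "i < 2 ^ K" "i < flip l i" for i
      using cmod_rotation[of "\<omega> (pair_angle l i)" "?e i" "?e (flip l i)"] that assms
      by (simp add: y_def sum_butterfly_layer flip_less flip_flip min.commute norm_mult mult.assoc)
    show ?thesis
    proof (cases "i < flip l i")
      case True
      then show ?thesis using lt that by simp
    next
      case False
      then have "flip l i < i" using flip_neq[of i l] by simp
      then show ?thesis using lt[of "flip l i"] that assms by (simp add: flip_less flip_flip)
    qed
  qed
  then have "(\<Sum>i<2 ^ K. (cmod (y i))\<^sup>2 + (cmod (y (flip l i)))\<^sup>2)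
      = (\<Sum>i<2 ^ K. (cmod (z i))\<^sup>2 + (cmod (z (flip l i)))\<^sup>2)"
    by (intro sum.cong) auto
  then show "(\<Sum>i<2 ^ K. (cmod (\<Sum>p<2 ^ K. butterfly_layer K (Suc l) \<omega> $$ (i, p) * z p))\<^sup>2)
      = (\<Sum>p<2 ^ K. (cmod (z p))\<^sup>2)"
    using sum_flip[OF assms, of "\<lambda>i. (cmod (y i))\<^sup>2"] sum_flip[OF assms, of "\<lambda>i. (cmod (z i))\<^sup>2"]
    by (simp add: sum.distrib y_def)
qed

lemma norm_preserving_butterfly_upto: "l \<le> K \<Longrightarrow> norm_preserving (butterfly_upto K \<omega> l)"
proof (induction l)
  case 0
  have "(\<Sum>p<n. 1\<^sub>m n $$ (i, p) * z p) = z i" if "i < n" for i n and z :: "nat \<Rightarrow> complex"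
  proof -
    have "(\<Sum>p<n. 1\<^sub>m n $$ (i, p) * z p) = (\<Sum>p<n. if i = p then z i else 0)"
      using that by (intro sum.cong) auto
    then show ?thesis using that by simp
  qed
  then show ?case by (simp add: norm_preserving_def)
next
  case (Suc l)
  then show ?case
    by (auto intro!: norm_preserving_mult norm_preserving_butterfly_layer
        simp: dim_butterfly_layer dim_butterfly_upto)
qed

lemma butterfly_upto_Suc_index:
  fixes \<omega> :: "angle \<Rightarrow> real"
  assumes l: "l < K" and i: "i < 2 ^ K" and p: "p < 2 ^ K"
  defines "\<theta> \<equiv> \<omega> (pair_angle l i)"
  shows "butterfly_upto K \<omega> (Suc l) $$ (i, p)
    = complex_of_real (cos \<theta>) * (cis (- \<omega> (Phase (Suc l) i)) * butterfly_upto K \<omega> l $$ (i, p))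
      + complex_of_real (sin \<theta>) * ((if i < flip l i then -1 else 1)
          * cis (- \<omega> (Phase (Suc l) (flip l i))) * butterfly_upto K \<omega> l $$ (flip l i, p))"
proof -
  have "butterfly_upto K \<omega> (Suc l) $$ (i, p)
      = (\<Sum>j<2 ^ K. butterfly_layer K (Suc l) \<omega> $$ (i, j) * butterfly_upto K \<omega> l $$ (j, p))"
    using i p by (simp add: index_mult_mat_sum dim_butterfly_layer dim_butterfly_upto
        del: index_mult_mat(1))
  then show ?thesis using sum_butterfly_layer[OF l i, of \<omega>] by (simp add: \<theta>_def)
qed

section \<open>Averaging over independent angles\<close>

definition uniform_angle :: "real measure" where
  "uniform_angle = uniform_measure lborel {0..<2 * pi}"

lemma emeasure_angle_interval: "emeasure lborel {0..<2 * pi} = ennreal (2 * pi)"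
  by simp

lemma prob_space_uniform_angle: "prob_space uniform_angle"
  unfolding uniform_angle_def using pi_gt_zero
  by (intro prob_space_uniform_measure) (simp_all only: emeasure_angle_interval, auto)

lemma sets_uniform_angle [measurable_cong]: "sets uniform_angle = sets borel"
  by (simp add: uniform_angle_def)

lemma space_uniform_angle: "space uniform_angle = UNIV"
  by (simp add: uniform_angle_def)

lemma uniform_angle_density:
  "uniform_angle = density lborel (\<lambda>x. ennreal (indicator {0..<2 * pi} x / (2 * pi)))"
  unfolding uniform_angle_def uniform_measure_def emeasure_angle_interval
  by (intro density_cong) (auto simp: divide_ennreal indicator_def simp flip: ennreal_1)

lemma integral_uniform_angle_FTC:
  fixes f F :: "real \<Rightarrow> real"
  assumes F: "\<And>x. (F has_real_derivative f x) (at x)" and f: "continuous_on UNIV f"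
  shows "(\<integral>x. f x \<partial>uniform_angle) = (F (2 * pi) - F 0) / (2 * pi)"
proof -
  have [measurable]: "f \<in> borel_measurable borel"
    using f by (rule borel_measurable_continuous_onI)
  have "(\<integral>x. f x \<partial>uniform_angle) = (\<integral>x. (indicator {0..<2 * pi} x / (2 * pi)) *\<^sub>R f x \<partial>lborel)"
    unfolding uniform_angle_density by (intro integral_density) auto
  \<comment> \<open>The angle lives on a half-open interval, the fundamental theorem on the closed
    one; the extra endpoint is a null set.\<close>
  also have "\<dots> = (\<integral>x. (indicator {0..2 * pi} x *\<^sub>R f x) / (2 * pi) \<partial>lborel)"
  proof (intro integral_cong_AE)
    show "AE x in lborel. (indicator {0..<2 * pi} x / (2 * pi)) *\<^sub>R f x
        = (indicator {0..2 * pi} x *\<^sub>R f x) / (2 * pi)"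
      using AE_lborel_singleton[of "2 * pi"] by eventually_elim (auto simp: indicator_def)
  qed auto
  also have "\<dots> = (\<integral>x. indicator {0..2 * pi} x *\<^sub>R f x \<partial>lborel) / (2 * pi)"
    by simp
  also have "(\<integral>x. indicator {0..2 * pi} x *\<^sub>R f x \<partial>lborel) = F (2 * pi) - F 0"
    using F f by (intro integral_FTC_atLeastAtMost)
      (auto simp: has_real_derivative_iff_has_vector_derivative[symmetric]
        intro: has_field_derivative_at_within continuous_on_subset)
  finally show ?thesis .
qed

text \<open>All moments below are combinations of these four harmonics; their primitives have period
  \<open>2 * pi\<close>, so only the constant term survives.\<close>

lemma integral_uniform_angle_trig:
  assumes "\<And>x. f x = a + b * cos (2 * x) + c * sin (2 * x) + d * cos (4 * x) + e * sin (4 * x)"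
  shows "(\<integral>x. f x \<partial>uniform_angle) = a"
proof -
  let ?F = "\<lambda>x. a * x + b / 2 * sin (2 * x) - c / 2 * cos (2 * x) + d / 4 * sin (4 * x) - e / 4 * cos (4 * x)"
  have "(\<integral>x. f x \<partial>uniform_angle) = (?F (2 * pi) - ?F 0) / (2 * pi)"
  proof (rule integral_uniform_angle_FTC)
    show "(?F has_real_derivative f x) (at x)" for x
      unfolding assms by (auto intro!: derivative_eq_intros)
    show "continuous_on UNIV f"
      unfolding assms[abs_def] by (intro continuous_intros)
  qed
  moreover have "cos (2 * (2 * pi)) = 1" "sin (2 * (2 * pi)) = 0" "cos (4 * (2 * pi)) = 1" "sin (4 * (2 * pi)) = 0"
    using cos_int_2pin[of 2] sin_int_2pin[of 2] cos_int_2pin[of 4] sin_int_2pin[of 4]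
    by (simp_all add: mult_ac)
  ultimately show ?thesis by simp
qed

lemma cos_squared_real: "(cos x)\<^sup>2 = 1 / 2 + 1 / 2 * cos (2 * x)" for x :: real
  using cos_double_cos[of x] by linarith

lemma sin_squared_real: "(sin x)\<^sup>2 = 1 / 2 - 1 / 2 * cos (2 * x)" for x :: real
  using cos_double_sin[of x] by linarith

lemma cos_sin_real: "cos x * sin x = 1 / 2 * sin (2 * x)" for x :: real
  by (simp add: sin_double)

text \<open>The moments of \<open>(cos x)\<^sup>2\<close>, \<open>(sin x)\<^sup>2\<close> and
  \<open>cos x * sin x\<close> produce the Markov step. Those of \<open>sin (2 * x)\<close>, the two
  double-angle squares and their mixed product normalise the test function and remove the
  interference. The last three, weighted by \<open>cos (2 * x)\<close>, turn an average over a flip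
  into a difference.\<close>

lemma double_angle_moments:
  shows "(\<integral>x. sin (2 * x) \<partial>uniform_angle) = 0"
    and "(\<integral>x. (cos x)\<^sup>2 \<partial>uniform_angle) = 1 / 2" "(\<integral>x. (sin x)\<^sup>2 \<partial>uniform_angle) = 1 / 2"
    and "(\<integral>x. cos x * sin x \<partial>uniform_angle) = 0"
    and "(\<integral>x. (sin (2 * x))\<^sup>2 \<partial>uniform_angle) = 1 / 2" "(\<integral>x. (cos (2 * x))\<^sup>2 \<partial>uniform_angle) = 1 / 2"
    and "(\<integral>x. cos (2 * x) * sin (2 * x) \<partial>uniform_angle) = 0"
    and "(\<integral>x. cos (2 * x) * (cos x)\<^sup>2 \<partial>uniform_angle) = 1 / 4"
    and "(\<integral>x. cos (2 * x) * (sin x)\<^sup>2 \<partial>uniform_angle) = - 1 / 4"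
    and "(\<integral>x. cos (2 * x) * (cos x * sin x) \<partial>uniform_angle) = 0"
proof -
  note r = integral_uniform_angle_trig
  have c4: "(cos (2 * x))\<^sup>2 = 1 / 2 + 1 / 2 * cos (4 * x)" for x :: real
    using cos_squared_real[of "2 * x"] by simp
  have s4: "(sin (2 * x))\<^sup>2 = 1 / 2 - 1 / 2 * cos (4 * x)" for x :: real
    using sin_squared_real[of "2 * x"] by simp
  have cs4: "cos (2 * x) * sin (2 * x) = 1 / 2 * sin (4 * x)" for x :: real
    using cos_sin_real[of "2 * x"] by simp
  show "(\<integral>x. sin (2 * x) \<partial>uniform_angle) = 0" by (rule r[of _ _ 0 1 0 0]) simp
  show "(\<integral>x. (cos x)\<^sup>2 \<partial>uniform_angle) = 1 / 2"
    by (rule r[of _ _ "1/2" 0 0 0]) (simp add: cos_squared_real)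
  show "(\<integral>x. (sin x)\<^sup>2 \<partial>uniform_angle) = 1 / 2"
    by (rule r[of _ _ "-1/2" 0 0 0]) (simp add: sin_squared_real)
  show "(\<integral>x. cos x * sin x \<partial>uniform_angle) = 0"
    by (rule r[of _ _ 0 "1/2" 0 0]) (simp add: cos_sin_real)
  show "(\<integral>x. (sin (2 * x))\<^sup>2 \<partial>uniform_angle) = 1 / 2"
    by (rule r[of _ _ 0 0 "-1/2" 0]) (simp add: s4)
  show "(\<integral>x. (cos (2 * x))\<^sup>2 \<partial>uniform_angle) = 1 / 2"
    by (rule r[of _ _ 0 0 "1/2" 0]) (simp add: c4)
  show "(\<integral>x. cos (2 * x) * sin (2 * x) \<partial>uniform_angle) = 0"
    by (rule r[of _ _ 0 0 0 "1/2"]) (simp add: cs4)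
  have "cos (2 * x) * (cos x)\<^sup>2 = 1 / 2 * cos (2 * x) + 1 / 2 * (cos (2 * x))\<^sup>2" for x :: real
    unfolding cos_squared_real[of x] by (simp add: power2_eq_square distrib_left)
  then show "(\<integral>x. cos (2 * x) * (cos x)\<^sup>2 \<partial>uniform_angle) = 1 / 4"
    by (intro r[of _ _ "1/2" 0 "1/4" 0]) (simp add: c4)
  have "cos (2 * x) * (sin x)\<^sup>2 = 1 / 2 * cos (2 * x) - 1 / 2 * (cos (2 * x))\<^sup>2" for x :: real
    unfolding sin_squared_real[of x] by (simp add: power2_eq_square right_diff_distrib)
  then show "(\<integral>x. cos (2 * x) * (sin x)\<^sup>2 \<partial>uniform_angle) = - 1 / 4"
    by (intro r[of _ _ "1/2" 0 "-1/4" 0]) (simp only: c4, simp add: field_simps)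
  have "cos (2 * x) * (cos x * sin x) = 1 / 4 * sin (4 * x)" for x :: real
    using cs4[of x] by (simp add: cos_sin_real)
  then show "(\<integral>x. cos (2 * x) * (cos x * sin x) \<partial>uniform_angle) = 0"
    by (intro r[of _ _ 0 0 0 "1/4"]) simp
qed

section \<open>Bounded measurable functions and the covariance bound\<close>

text \<open>Integrability is not stable under products. Boundedness is, and over a probability space
  it makes every expectation below exist.\<close>

definition bounded_measurable :: "'a measure \<Rightarrow> ('a \<Rightarrow> 'b :: real_normed_vector) \<Rightarrow> bool" where
  "bounded_measurable M f \<longleftrightarrow> f \<in> borel_measurable M \<and> (\<exists>B. \<forall>x. norm (f x) \<le> B)"

named_theorems bounded_measurable_intros

lemma bounded_measurable_const [bounded_measurable_intros]: "bounded_measurable M (\<lambda>_. c)"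
  by (auto simp: bounded_measurable_def)

lemma bounded_measurable_add [bounded_measurable_intros]:
  fixes f g :: "'a \<Rightarrow> 'b :: {real_normed_vector, second_countable_topology}"
  assumes "bounded_measurable M f" "bounded_measurable M g"
  shows "bounded_measurable M (\<lambda>x. f x + g x)"
proof -
  obtain B C where "\<And>x. norm (f x) \<le> B" "\<And>x. norm (g x) \<le> C"
    using assms unfolding bounded_measurable_def by blast
  then have "norm (f x + g x) \<le> B + C" for x by (intro norm_triangle_mono) auto
  then show ?thesis using assms unfolding bounded_measurable_def by (blast intro: borel_measurable_add)
qed

lemma bounded_measurable_mult [bounded_measurable_intros]:
  fixes f g :: "'a \<Rightarrow> 'b :: {real_normed_algebra, second_countable_topology}"
  assumes "bounded_measurable M f" "bounded_measurable M g"
  shows "bounded_measurable M (\<lambda>x. f x * g x)"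
proof -
  obtain B C where B: "\<And>x. norm (f x) \<le> B" and C: "\<And>x. norm (g x) \<le> C"
    using assms unfolding bounded_measurable_def by blast
  have "norm (f x * g x) \<le> B * C" for x
    using norm_mult_ineq[of "f x" "g x"] mult_mono'[OF B[of x] C[of x]] by simp
  then show ?thesis using assms unfolding bounded_measurable_def by (blast intro: borel_measurable_times)
qed

lemma bounded_measurable_diff [bounded_measurable_intros]:
  fixes f g :: "'a \<Rightarrow> real"
  assumes "bounded_measurable M f" "bounded_measurable M g"
  shows "bounded_measurable M (\<lambda>x. f x - g x)"
  using bounded_measurable_add[OF assms(1) bounded_measurable_mult[OF bounded_measurable_const assms(2)], of "-1"]
  by simp

lemma bounded_measurable_sum [bounded_measurable_intros]:
  fixes f :: "'i \<Rightarrow> 'a \<Rightarrow> 'b :: {real_normed_vector, second_countable_topology}"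
  assumes "\<And>i. i \<in> A \<Longrightarrow> bounded_measurable M (f i)"
  shows "bounded_measurable M (\<lambda>x. \<Sum>i\<in>A. f i x)"
  using assms
  by (induction A rule: infinite_finite_induct) (auto intro!: bounded_measurable_intros)

lemma bounded_measurable_continuous:
  fixes f :: "'a \<Rightarrow> 'b :: real_normed_vector" and g :: "'b \<Rightarrow> 'c :: real_normed_vector"
  assumes "bounded_measurable M f" "continuous_on UNIV g" "\<And>x. norm (g x) \<le> norm x"
  shows "bounded_measurable M (\<lambda>x. g (f x))"
proof -
  obtain B where "\<And>x. norm (f x) \<le> B" using assms unfolding bounded_measurable_def by blast
  then have "norm (g (f x)) \<le> B" for x using assms(3) order_trans by blast
  moreover have "(\<lambda>x. g (f x)) \<in> borel_measurable M"
    using assms borel_measurable_continuous_onI[OF assms(2)]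
    unfolding bounded_measurable_def by (auto intro: measurable_compose)
  ultimately show ?thesis unfolding bounded_measurable_def by blast
qed

lemma bounded_measurable_cnj [bounded_measurable_intros]:
  "bounded_measurable M f \<Longrightarrow> bounded_measurable M (\<lambda>x. cnj (f x))"
  by (rule bounded_measurable_continuous) (auto intro!: continuous_intros)

lemma bounded_measurable_Re [bounded_measurable_intros]:
  "bounded_measurable M f \<Longrightarrow> bounded_measurable M (\<lambda>x. Re (f x))"
  by (rule bounded_measurable_continuous) (auto intro!: continuous_intros simp: abs_Re_le_cmod)

lemma bounded_measurable_cmod [bounded_measurable_intros]:
  "bounded_measurable M f \<Longrightarrow> bounded_measurable M (\<lambda>x. cmod (f x))"
  by (rule bounded_measurable_continuous) (auto intro!: continuous_intros)

lemma bounded_measurable_of_real [bounded_measurable_intros]: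
  "bounded_measurable M f \<Longrightarrow> bounded_measurable M (\<lambda>x. complex_of_real (f x))"
  by (rule bounded_measurable_continuous) (auto intro!: continuous_intros)

lemma bounded_measurable_power2 [bounded_measurable_intros]:
  fixes f :: "'a \<Rightarrow> real"
  shows "bounded_measurable M f \<Longrightarrow> bounded_measurable M (\<lambda>x. (f x)\<^sup>2)"
  unfolding power2_eq_square by (intro bounded_measurable_intros)

lemma bounded_measurable_bounded_fun:
  fixes g :: "real \<Rightarrow> 'b :: real_normed_vector"
  assumes "f \<in> borel_measurable M" "continuous_on UNIV g" "\<And>x. norm (g x) \<le> 1"
  shows "bounded_measurable M (\<lambda>x. g (f x))"
  using assms measurable_compose[OF assms(1) borel_measurable_continuous_onI[OF assms(2)]]
  unfolding bounded_measurable_def by blast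

lemma (in prob_space) integrable_bounded_measurable:
  fixes f :: "'a \<Rightarrow> 'b :: {banach, second_countable_topology}"
  assumes "bounded_measurable M f"
  shows "integrable M f"
  using assms unfolding bounded_measurable_def by (auto intro: integrable_const_bound)

text \<open>Cauchy-Schwarz through linear regression: the residual of \<open>X\<close> after
  regressing on \<open>g\<close> has nonnegative second moment. The optimal slope is the covariance
  \<open>c\<close> divided by \<open>1 / 4\<close>, hence \<open>4 * c\<close>.\<close>

lemma (in prob_space) variance_ge_covariance:
  fixes X g :: "'a \<Rightarrow> real"
  assumes X: "bounded_measurable M X" and g: "bounded_measurable M g"
    and "expectation g = 0" "expectation (\<lambda>x. (g x)\<^sup>2) = 1 / 4"
  shows "4 * (expectation (\<lambda>x. X x * g x))\<^sup>2 \<le> variance X"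
proof -
  define e c where "e = expectation X" and "c = expectation (\<lambda>x. X x * g x)"
  note int = integrable_bounded_measurable
  note [simp] = int[OF X] int[OF g] int[OF bounded_measurable_mult[OF X g]]
    int[OF bounded_measurable_power2[OF g]]
    int[OF bounded_measurable_power2[OF bounded_measurable_diff[OF X bounded_measurable_const]]]
  have "0 \<le> expectation (\<lambda>x. (X x - e - 4 * c * g x)\<^sup>2)" by (intro Bochner_Integration.integral_nonneg) simp
  also have "(\<lambda>x. (X x - e - 4 * c * g x)\<^sup>2)
      = (\<lambda>x. (X x - e)\<^sup>2 - 8 * c * (X x * g x) + 8 * c * e * g x + 16 * c\<^sup>2 * (g x)\<^sup>2)"
    by (auto simp: power2_eq_square algebra_simps)
  also have "expectation \<dots> = variance X - 8 * c * c + 8 * c * e * 0 + 16 * c\<^sup>2 * (1 / 4)"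
    using assms(3,4) by (simp add: e_def[symmetric] c_def[symmetric])
  finally show ?thesis by (simp add: c_def[symmetric] power2_eq_square)
qed

section \<open>Splitting off a single angle\<close>

abbreviation angles :: "nat \<Rightarrow> angle set" where
  "angles K \<equiv> rbs_angles K \<union> phase_angles K"

lemma finite_angles: "finite (angles K)"
proof -
  have "rbs_angles K \<subseteq> (\<lambda>(l, a). RBS l a) ` ({1..K} \<times> {..<2 ^ K})"
    by (force simp: rbs_angles_def)
  moreover have "phase_angles K \<subseteq> (\<lambda>(l, a). Phase l a) ` ({1..K} \<times> {..<2 ^ K})"
    by (force simp: phase_angles_def)
  ultimately show ?thesis by (auto intro: finite_subset)
qed

lemma random_init_eq: "random_init K = Pi\<^sub>M (angles K) (\<lambda>_. uniform_angle)"
  by (simp add: random_init_def uniform_angle_def)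

lemma prob_space_random_init: "prob_space (random_init K)"
  unfolding random_init_eq by (intro prob_space_PiM prob_space_uniform_angle)

lemma measurable_angle:
  assumes "\<theta> \<in> angles K"
  shows "(\<lambda>\<omega>. \<omega> \<theta>) \<in> borel_measurable (random_init K)"
proof -
  have "(\<lambda>\<omega>. \<omega> \<theta>) \<in> measurable (random_init K) uniform_angle"
    unfolding random_init_eq using assms by (rule measurable_component_singleton)
  then show ?thesis by (simp add: measurable_def sets_uniform_angle space_uniform_angle)
qed

lemma bounded_measurable_angle:
  assumes "\<theta> \<in> angles K" "continuous_on UNIV u" "\<And>x. norm (u x) \<le> 1"
  shows "bounded_measurable (random_init K) (\<lambda>\<omega>. u (\<omega> \<theta>))"
  using assms by (intro bounded_measurable_bounded_fun measurable_angle)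

text \<open>Independence is phrased as invariance of \<open>c\<close> under changes of the
  coordinate, which can be read off from the circuit. Fubini with that coordinate split off does the
  rest.\<close>

lemma expectation_independent_angle:
  fixes c :: "(angle \<Rightarrow> real) \<Rightarrow> real" and u :: "real \<Rightarrow> real"
  assumes \<theta>: "\<theta> \<in> angles K" and c: "bounded_measurable (random_init K) c"
    and inv: "\<And>\<omega> t. c (fun_upd \<omega> \<theta> t) = c \<omega>"
    and u: "continuous_on UNIV u" "\<And>x. norm (u x) \<le> 1"
  shows "(\<integral>\<omega>. c \<omega> * u (\<omega> \<theta>) \<partial>random_init K) = (\<integral>\<omega>. c \<omega> \<partial>random_init K) * (\<integral>x. u x \<partial>uniform_angle)"
proof -
  interpret P: prob_space "random_init K" by (rule prob_space_random_init)
  interpret U: prob_space uniform_angle by (rule prob_space_uniform_angle)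
  interpret product_sigma_finite "\<lambda>_::angle. uniform_angle"
    by unfold_locales
  define J where "J = angles K - {\<theta>}"
  have J: "finite J" "\<theta> \<notin> J" "random_init K = Pi\<^sub>M (insert \<theta> J) (\<lambda>_. uniform_angle)"
    using \<theta> finite_angles[of K] by (auto simp: J_def random_init_eq insert_absorb)
  have ic: "integrable (random_init K) c"
    using c by (rule P.integrable_bounded_measurable)
  have icu: "integrable (random_init K) (\<lambda>\<omega>. c \<omega> * u (\<omega> \<theta>))"
    using c \<theta> u by (intro P.integrable_bounded_measurable bounded_measurable_mult bounded_measurable_angle)
  have "(\<integral>\<omega>. c \<omega> * u (\<omega> \<theta>) \<partial>random_init K)
      = (\<integral>\<omega>. (\<integral>y. c (fun_upd \<omega> \<theta> y) * u ((fun_upd \<omega> \<theta> y) \<theta>) \<partial>uniform_angle) \<partial>Pi\<^sub>M J (\<lambda>_. uniform_angle))"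
    using product_integral_insert[OF J(1,2)] icu unfolding J(3) by blast
  also have "\<dots> = (\<integral>\<omega>. c \<omega> \<partial>Pi\<^sub>M J (\<lambda>_. uniform_angle)) * (\<integral>x. u x \<partial>uniform_angle)"
    by (simp add: inv)
  \<comment> \<open>Points of the smaller product carry a default value at the removed angle, which
    \<open>inv\<close> makes harmless; the same Fubini step, run backwards, returns to the full
    product.\<close>
  also have "(\<integral>\<omega>. c \<omega> \<partial>Pi\<^sub>M J (\<lambda>_. uniform_angle))
      = (\<integral>\<omega>. (\<integral>y. c (fun_upd \<omega> \<theta> y) \<partial>uniform_angle) \<partial>Pi\<^sub>M J (\<lambda>_. uniform_angle))"
    by (simp add: inv U.prob_space)
  also have "\<dots> = (\<integral>\<omega>. c \<omega> \<partial>random_init K)"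
    using product_integral_insert[OF J(1,2)] ic unfolding J(3) by metis
  finally show ?thesis .
qed

section \<open>The pair weight under the butterfly\<close>

context
  fixes n :: nat and X :: "'s set" and F :: "nat \<Rightarrow> nat \<Rightarrow> 's \<Rightarrow> complex"
begin

text \<open>\<open>F p q S\<close> will be the amplitude of \<open>f_p f_q\<close> applied to the
  encoded state, at the basis vector \<open>S\<close>, and \<open>u\<close>, \<open>v\<close> will
  be two rows of the circuit matrix. For antisymmetric \<open>F\<close> this is an alternating
  bilinear form.\<close>

definition pair_amplitude :: "(nat \<Rightarrow> complex) \<Rightarrow> (nat \<Rightarrow> complex) \<Rightarrow> 's \<Rightarrow> complex" where
  "pair_amplitude u v S = (\<Sum>p<n. \<Sum>q<n. u p * v q * F p q S)"

definition pair_weight :: "(nat \<Rightarrow> complex) \<Rightarrow> (nat \<Rightarrow> complex) \<Rightarrow> real" where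
  "pair_weight u v = (\<Sum>S\<in>X. (cmod (pair_amplitude u v S))\<^sup>2)"

text \<open>The polarisation term of the squared norm when \<open>u\<close> and \<open>u'\<close>
  are superposed.\<close>

definition pair_cross :: "(nat \<Rightarrow> complex) \<Rightarrow> (nat \<Rightarrow> complex) \<Rightarrow> (nat \<Rightarrow> complex) \<Rightarrow> real" where
  "pair_cross u u' v = (\<Sum>S\<in>X. 2 * Re (pair_amplitude u v S * cnj (pair_amplitude u' v S)))"

lemma pair_amplitude_linear:
  assumes "\<And>p. p < n \<Longrightarrow> w p = c * u p + s * u' p"
  shows "pair_amplitude w v S = c * pair_amplitude u v S + s * pair_amplitude u' v S"
  unfolding pair_amplitude_def sum_distrib_left sum.distrib[symmetric]
  by (intro sum.cong refl) (simp add: assms algebra_simps)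

lemma pair_weight_rotate:
  assumes "\<And>p. p < n \<Longrightarrow> w p = complex_of_real c * (e * u p) + complex_of_real s * (e' * u' p)"
    and "cmod e = 1" "cmod e' = 1"
  shows "pair_weight w v = pair_weight u v * c\<^sup>2 + pair_weight u' v * s\<^sup>2
    + pair_cross (\<lambda>p. e * u p) (\<lambda>p. e' * u' p) v * (c * s)"
proof -
  have sq: "(cmod (complex_of_real c * x + complex_of_real s * y))\<^sup>2
      = (cmod x)\<^sup>2 * c\<^sup>2 + (cmod y)\<^sup>2 * s\<^sup>2 + 2 * Re (x * cnj y) * (c * s)" for x y
    unfolding cmod_power2 by (simp add: power2_eq_square algebra_simps)
  have e: "pair_amplitude (\<lambda>p. e * u p) v S = e * pair_amplitude u v S" for S e u
    using pair_amplitude_linear[of "\<lambda>p. e * u p" e u 0 u v S] by simp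
  show ?thesis
    unfolding pair_weight_def pair_cross_def sum_distrib_right sum.distrib[symmetric]
    by (intro sum.cong refl, subst pair_amplitude_linear[OF assms(1)])
      (simp_all add: sq e norm_mult power_mult_distrib assms(2,3))
qed

context
  assumes F_antisym: "\<And>p q S. p < n \<Longrightarrow> q < n \<Longrightarrow> F p q S = - F q p S"
begin

lemma pair_amplitude_antisym: "pair_amplitude v u S = - pair_amplitude u v S"
proof -
  have "pair_amplitude v u S = (\<Sum>q<n. \<Sum>p<n. v p * u q * F p q S)"
    unfolding pair_amplitude_def by (rule sum.swap)
  also have "\<dots> = (\<Sum>q<n. \<Sum>p<n. - (u q * v p * F q p S))"
    by (intro sum.cong refl) (subst F_antisym, auto)
  finally show ?thesis by (simp add: pair_amplitude_def sum_negf)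
qed

lemma pair_weight_sym: "pair_weight v u = pair_weight u v"
  by (simp add: pair_weight_def pair_amplitude_antisym[of v u])

text \<open>Source of the exclusion: on an alternating form, mixing the two arguments among
  themselves acts by the determinant, here \<open>e * e'\<close> times
  \<open>cos t * cos t + sin t * sin t\<close>, which has modulus 1.\<close>

lemma pair_weight_rotate_both:
  assumes w: "\<And>p. p < n \<Longrightarrow> w p = complex_of_real (cos t) * (e * u p) + complex_of_real (sin t) * (- e' * u' p)"
    and w': "\<And>p. p < n \<Longrightarrow> w' p = complex_of_real (cos t) * (e' * u' p) + complex_of_real (sin t) * (e * u p)"
    and e: "cmod e = 1" "cmod e' = 1"
  shows "pair_weight w w' = pair_weight u u'"
proof -
  define b where "b u v S = pair_amplitude u v S" for u v S
  have zero: "b u u S = 0" for u S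
    using pair_amplitude_antisym[of u u S] unfolding b_def by (simp add: eq_neg_iff_add_eq_0 flip: mult_2)
  have lin1: "b w v S = (cos t * e) * b u v S + (- sin t * e') * b u' v S" for v S
    unfolding b_def by (rule pair_amplitude_linear) (simp add: w)
  have lin2: "b w' v S = (cos t * e') * b u' v S + (sin t * e) * b u v S" for v S
    unfolding b_def by (rule pair_amplitude_linear) (simp add: w')
  have anti: "b v u S = - b u v S" for u v S unfolding b_def by (rule pair_amplitude_antisym)
  have "b w w' S = e * e' * b u u' S" for S
  proof -
    have "complex_of_real (cos t * cos t + sin t * sin t) = 1"
      by (simp only: sin_cos_squared_add3 of_real_1)
    then have cs: "complex_of_real (cos t) * complex_of_real (cos t)
        + complex_of_real (sin t) * complex_of_real (sin t) = 1"
      by (simp only: of_real_add of_real_mult)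
    have "b u w' S = - (cos t * e') * b u' u S" "b u' w' S = - (sin t * e) * b u u' S"
      using anti[of u w'] anti[of u' w'] lin2 zero by simp_all
    then have "b w w' S = (complex_of_real (cos t) * complex_of_real (cos t)
        + complex_of_real (sin t) * complex_of_real (sin t)) * (e * e' * b u u' S)"
      unfolding lin1 anti[of u' u] by (simp add: algebra_simps)
    then show ?thesis unfolding cs by simp
  qed
  then show ?thesis by (simp add: pair_weight_def b_def norm_mult e)
qed

end
end

section \<open>Dependence of the rows on the angles\<close>

abbreviation row :: "nat \<Rightarrow> nat \<Rightarrow> (angle \<Rightarrow> real) \<Rightarrow> nat \<Rightarrow> nat \<Rightarrow> complex" where
  "row K l \<omega> i p \<equiv> butterfly_upto K \<omega> l $$ (i, p)"

definition phase_here :: "nat \<Rightarrow> (angle \<Rightarrow> real) \<Rightarrow> nat \<Rightarrow> complex" where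
  "phase_here l \<omega> i = cis (- \<omega> (Phase (Suc l) i))"

text \<open>The factor of the partner row; its sign is that of the sine entry of the rotation,
  negative in the row of the smaller member.\<close>

definition phase_there :: "nat \<Rightarrow> (angle \<Rightarrow> real) \<Rightarrow> nat \<Rightarrow> complex" where
  "phase_there l \<omega> i = (if i < flip l i then -1 else 1) * cis (- \<omega> (Phase (Suc l) (flip l i)))"

lemma cmod_phase: "cmod (phase_here l \<omega> i) = 1" "cmod (phase_there l \<omega> i) = 1"
  by (simp_all add: phase_here_def phase_there_def norm_mult)

lemma phase_fun_upd:
  "phase_here l (fun_upd \<omega> (RBS l' a) t) i = phase_here l \<omega> i"
  "phase_there l (fun_upd \<omega> (RBS l' a) t) i = phase_there l \<omega> i"
  by (simp_all add: phase_here_def phase_there_def)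

lemma row_Suc:
  assumes "l < K" "i < 2 ^ K" "p < 2 ^ K"
  shows "row K (Suc l) \<omega> i p
    = complex_of_real (cos (\<omega> (pair_angle l i))) * (phase_here l \<omega> i * row K l \<omega> i p)
      + complex_of_real (sin (\<omega> (pair_angle l i))) * (phase_there l \<omega> i * row K l \<omega> (flip l i) p)"
  using butterfly_upto_Suc_index[OF assms, of \<omega>] by (simp add: phase_here_def phase_there_def)

lemma butterfly_upto_fun_upd:
  "l < l' \<Longrightarrow> butterfly_upto K (fun_upd \<omega> (RBS l' a) t) l = butterfly_upto K \<omega> l"
proof (induction l)
  case (Suc l)
  have "butterfly_layer K (Suc l) (fun_upd \<omega> (RBS l' a) t) = butterfly_layer K (Suc l) \<omega>"
    using Suc.prems by (simp add: butterfly_layer_def rbs_layer_def)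
  then show ?case using Suc by (simp del: fun_upd_apply)
qed simp

lemma row_Suc_fun_upd:
  assumes "l < K" "i < 2 ^ K" "p < 2 ^ K" "RBS (Suc l) a \<noteq> pair_angle l i"
  shows "row K (Suc l) (fun_upd \<omega> (RBS (Suc l) a) t) i p = row K (Suc l) \<omega> i p"
proof -
  have "(fun_upd \<omega> (RBS (Suc l) a) t) (pair_angle l i) = \<omega> (pair_angle l i)"
    using assms(4) by (metis fun_upd_other)
  then show ?thesis
    by (simp only: row_Suc[OF assms(1-3)] phase_fun_upd butterfly_upto_fun_upd[OF lessI])
qed

lemma pair_angle_rbs:
  assumes "l < K" "i < 2 ^ K"
  shows "pair_angle l i \<in> rbs_angles K"
proof -
  let ?a = "min i (flip l i)"
  have "?a < 2 ^ K" using assms by (simp add: min_def)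
  moreover have "?a < flip l ?a"
    using flip_neq[of i l] by (auto simp: min_def flip_flip)
  ultimately show ?thesis using assms(1) by (auto simp: rbs_angles_def partner_Suc)
qed

lemma pair_angle_neq: "i \<noteq> j \<Longrightarrow> j \<noteq> flip l i \<Longrightarrow> pair_angle l i \<noteq> pair_angle l j"
  by (metis angle.inject(1) flip_flip min_def)

lemma bounded_measurable_cis_angle:
  assumes "l \<in> {1..K}" "j < 2 ^ K"
  shows "bounded_measurable (random_init K) (\<lambda>\<omega>. cis (- \<omega> (Phase l j)))"
  using assms by (intro bounded_measurable_angle[where u="\<lambda>t. cis (- t)"])
    (auto simp: phase_angles_def intro!: continuous_intros)

lemma bounded_measurable_phase:
  assumes "l < K" "i < 2 ^ K"
  shows "bounded_measurable (random_init K) (\<lambda>\<omega>. phase_here l \<omega> i)"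
    and "bounded_measurable (random_init K) (\<lambda>\<omega>. phase_there l \<omega> i)"
  unfolding phase_here_def phase_there_def using assms
  by (intro bounded_measurable_intros bounded_measurable_cis_angle flip_less; simp)+

lemma bounded_measurable_trig_angle:
  assumes "l < K" "i < 2 ^ K"
  shows "bounded_measurable (random_init K) (\<lambda>\<omega>. cos (c * \<omega> (pair_angle l i)))"
    and "bounded_measurable (random_init K) (\<lambda>\<omega>. sin (c * \<omega> (pair_angle l i)))"
  using pair_angle_rbs[OF assms]
  by (auto intro!: bounded_measurable_angle[where u="\<lambda>t. cos (c * t)"]
      bounded_measurable_angle[where u="\<lambda>t. sin (c * t)"] continuous_intros)

lemma bounded_measurable_row:
  "l \<le> K \<Longrightarrow> i < 2 ^ K \<Longrightarrow> p < 2 ^ K \<Longrightarrow> bounded_measurable (random_init K) (\<lambda>\<omega>. row K l \<omega> i p)"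
proof (induction l arbitrary: i)
  case 0
  then show ?case by (simp add: bounded_measurable_const)
next
  case (Suc l)
  then have l: "l < K" and l': "l \<le> K" by auto
  \<comment> \<open>The factor \<open>1\<close> inside cosine and sine selects the instance
    \<open>c = 1\<close> of \<open>bounded_measurable_trig_angle\<close>.\<close>
  have "(\<lambda>\<omega>. row K (Suc l) \<omega> i p) = (\<lambda>\<omega>.
      complex_of_real (cos (1 * \<omega> (pair_angle l i))) * (phase_here l \<omega> i * row K l \<omega> i p)
      + complex_of_real (sin (1 * \<omega> (pair_angle l i))) * (phase_there l \<omega> i * row K l \<omega> (flip l i) p))"
    by (simp only: row_Suc[OF l Suc.prems(2,3)] mult_1_left)
  then show ?case
    by (simp only:) (intro bounded_measurable_intros bounded_measurable_phase
        bounded_measurable_trig_angle Suc.IH l l' flip_less Suc.prems)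
qed

lemma bounded_measurable_pair_weight:
  assumes "\<And>p. p < n \<Longrightarrow> bounded_measurable M (\<lambda>\<omega>. u \<omega> p)"
    and "\<And>p. p < n \<Longrightarrow> bounded_measurable M (\<lambda>\<omega>. v \<omega> p)"
  shows "bounded_measurable M (\<lambda>\<omega>. pair_weight n X F (u \<omega>) (v \<omega>))"
  unfolding pair_weight_def pair_amplitude_def using assms by (intro bounded_measurable_intros) auto

lemma bounded_measurable_pair_cross:
  assumes "\<And>p. p < n \<Longrightarrow> bounded_measurable M (\<lambda>\<omega>. u \<omega> p)"
    and "\<And>p. p < n \<Longrightarrow> bounded_measurable M (\<lambda>\<omega>. u' \<omega> p)"
    and "\<And>p. p < n \<Longrightarrow> bounded_measurable M (\<lambda>\<omega>. v \<omega> p)"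
  shows "bounded_measurable M (\<lambda>\<omega>. pair_cross n X F (u \<omega>) (u' \<omega>) (v \<omega>))"
  unfolding pair_cross_def pair_amplitude_def using assms by (intro bounded_measurable_intros) auto

lemma pair_weight_cong:
  assumes "\<And>p. p < n \<Longrightarrow> u p = u' p" "\<And>p. p < n \<Longrightarrow> v p = v' p"
  shows "pair_weight n X F u v = pair_weight n X F u' v'"
  unfolding pair_weight_def pair_amplitude_def using assms by (intro sum.cong refl arg_cong[where f="\<lambda>x. (cmod x)\<^sup>2"]) auto

lemma pair_cross_cong:
  assumes "\<And>p. p < n \<Longrightarrow> v p = v' p"
  shows "pair_cross n X F u w v = pair_cross n X F u w v'"
proof -
  have "pair_amplitude n F u v S = pair_amplitude n F u v' S" for u S
    unfolding pair_amplitude_def using assms by (intro sum.cong refl) auto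
  then show ?thesis by (simp add: pair_cross_def)
qed

lemma trig_product_le_1:
  fixes x y :: real
  shows "norm (cos x * sin y) \<le> (1::real)" "norm ((cos x)\<^sup>2) \<le> (1::real)" "norm ((sin x)\<^sup>2) \<le> (1::real)"
proof -
  have "\<bar>cos x\<bar> * \<bar>sin y\<bar> \<le> 1 * 1" by (intro mult_mono) auto
  then show "norm (cos x * sin y) \<le> (1::real)" by (simp add: abs_mult)
  show "norm ((cos x)\<^sup>2) \<le> (1::real)" "norm ((sin x)\<^sup>2) \<le> (1::real)"
    by (simp_all add: abs_square_le_1)
qed

section \<open>Markov steps for the mean weights\<close>

context
  fixes K :: nat and X :: "'s set" and F :: "nat \<Rightarrow> nat \<Rightarrow> 's \<Rightarrow> complex"
  assumes F_antisym: "\<And>p q S. p < 2 ^ K \<Longrightarrow> q < 2 ^ K \<Longrightarrow> F p q S = - F q p S"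
begin

abbreviation "weight \<equiv> pair_weight (2 ^ K) X F"

abbreviation "interference l i \<omega> v \<equiv> pair_cross (2 ^ K) X F
  (\<lambda>p. phase_here l \<omega> i * row K l \<omega> i p) (\<lambda>p. phase_there l \<omega> i * row K l \<omega> (flip l i) p) v"

abbreviation "mean_weight l a b \<equiv> (\<integral>\<omega>. weight (row K l \<omega> a) (row K l \<omega> b) \<partial>random_init K)"

lemma weight_row_Suc:
  assumes "l < K" "i < 2 ^ K"
  shows "weight (row K (Suc l) \<omega> i) v
    = weight (row K l \<omega> i) v * (cos (\<omega> (pair_angle l i)))\<^sup>2
      + weight (row K l \<omega> (flip l i)) v * (sin (\<omega> (pair_angle l i)))\<^sup>2
      + interference l i \<omega> v * (cos (\<omega> (pair_angle l i)) * sin (\<omega> (pair_angle l i)))"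
  by (rule pair_weight_rotate) (simp_all only: row_Suc[OF assms] cmod_phase)

lemma bounded_measurable_interference:
  assumes "l < K" "i < 2 ^ K" "\<And>p. p < 2 ^ K \<Longrightarrow> bounded_measurable (random_init K) (\<lambda>\<omega>. v \<omega> p)"
  shows "bounded_measurable (random_init K) (\<lambda>\<omega>. interference l i \<omega> (v \<omega>))"
  using assms by (intro bounded_measurable_pair_cross bounded_measurable_mult bounded_measurable_phase
    bounded_measurable_row flip_less) auto

text \<open>With all other angles fixed, the weight combines the squared cosine, the squared sine
  and their mixed product with coefficients free of this angle, so each expectation factors. The
  test function \<open>u\<close> is constant for a Markov step and \<open>cos (2 * x)\<close> for
  the last layer.\<close>

lemma expectation_weight_Suc:
  assumes l: "l < K" and i: "i < 2 ^ K"
    and v: "\<And>p. p < 2 ^ K \<Longrightarrow> bounded_measurable (random_init K) (\<lambda>\<omega>. v \<omega> p)"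
    and inv: "\<And>\<omega> t p. p < 2 ^ K \<Longrightarrow> v (fun_upd \<omega> (pair_angle l i) t) p = v \<omega> p"
    and u: "continuous_on UNIV u" "\<And>x. norm (u x) \<le> (1::real)"
  shows "(\<integral>\<omega>. u (\<omega> (pair_angle l i)) * weight (row K (Suc l) \<omega> i) (v \<omega>) \<partial>random_init K)
    = (\<integral>\<omega>. weight (row K l \<omega> i) (v \<omega>) \<partial>random_init K) * (\<integral>x. u x * (cos x)\<^sup>2 \<partial>uniform_angle)
      + (\<integral>\<omega>. weight (row K l \<omega> (flip l i)) (v \<omega>) \<partial>random_init K) * (\<integral>x. u x * (sin x)\<^sup>2 \<partial>uniform_angle)
      + (\<integral>\<omega>. interference l i \<omega> (v \<omega>) \<partial>random_init K) * (\<integral>x. u x * (cos x * sin x) \<partial>uniform_angle)"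
proof -
  interpret P: prob_space "random_init K" by (rule prob_space_random_init)
  let ?\<theta> = "pair_angle l i"
  have \<theta>: "?\<theta> \<in> angles K" using pair_angle_rbs[OF l i] by simp
  have i': "flip l i < 2 ^ K" using flip_less[OF l i] .
  have bm: "bounded_measurable (random_init K) (\<lambda>\<omega>. weight (row K l \<omega> i) (v \<omega>))"
    "bounded_measurable (random_init K) (\<lambda>\<omega>. weight (row K l \<omega> (flip l i)) (v \<omega>))"
    using l i i' v by (auto intro!: bounded_measurable_pair_weight bounded_measurable_row)
  note bm = bm bounded_measurable_interference[OF l i v]
  have upd: "weight (row K l (fun_upd \<omega> ?\<theta> t) j) (v (fun_upd \<omega> ?\<theta> t)) = weight (row K l \<omega> j) (v \<omega>)"
    "interference l i (fun_upd \<omega> ?\<theta> t) (v (fun_upd \<omega> ?\<theta> t)) = interference l i \<omega> (v \<omega>)" for \<omega> t j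
    by (simp_all only: butterfly_upto_fun_upd[OF lessI] phase_fun_upd)
      (rule pair_weight_cong pair_cross_cong; simp only: inv)+
  have prod: "continuous_on UNIV (\<lambda>x. u x * w x)" "norm (u x * w x) \<le> 1"
    if "continuous_on UNIV w" "\<And>x. norm (w x) \<le> 1" for w x
    using that u mult_mono[OF u(2)[of x] that(2)[of x]] by (auto intro!: continuous_intros simp: abs_mult)
  have E: "(\<integral>\<omega>. c \<omega> * (u (\<omega> ?\<theta>) * w (\<omega> ?\<theta>)) \<partial>random_init K)
      = (\<integral>\<omega>. c \<omega> \<partial>random_init K) * (\<integral>x. u x * w x \<partial>uniform_angle)"
    and I: "integrable (random_init K) (\<lambda>\<omega>. c \<omega> * (u (\<omega> ?\<theta>) * w (\<omega> ?\<theta>)))"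
    if "bounded_measurable (random_init K) c" "\<And>\<omega> t. c (fun_upd \<omega> ?\<theta> t) = c \<omega>"
      "continuous_on UNIV w" "\<And>x. norm (w x) \<le> 1" for c w
    using expectation_independent_angle[OF \<theta> that(1,2) prod[OF that(3,4)]]
      P.integrable_bounded_measurable[OF bounded_measurable_mult[OF that(1)
        bounded_measurable_angle[OF \<theta> prod[OF that(3,4)]]]] by simp_all
  have "(\<lambda>\<omega>. u (\<omega> ?\<theta>) * weight (row K (Suc l) \<omega> i) (v \<omega>))
      = (\<lambda>\<omega>. weight (row K l \<omega> i) (v \<omega>) * (u (\<omega> ?\<theta>) * (cos (\<omega> ?\<theta>))\<^sup>2)
        + weight (row K l \<omega> (flip l i)) (v \<omega>) * (u (\<omega> ?\<theta>) * (sin (\<omega> ?\<theta>))\<^sup>2)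
        + interference l i \<omega> (v \<omega>) * (u (\<omega> ?\<theta>) * (cos (\<omega> ?\<theta>) * sin (\<omega> ?\<theta>))))"
    unfolding weight_row_Suc[OF l i] by (auto simp: algebra_simps)
  moreover have c: "continuous_on UNIV (\<lambda>x::real. (cos x)\<^sup>2)" "continuous_on UNIV (\<lambda>x::real. (sin x)\<^sup>2)"
    "continuous_on UNIV (\<lambda>x::real. cos x * sin x)" by (intro continuous_intros)+
  note w = c(1) trig_product_le_1(2) c(2) trig_product_le_1(3) c(3) trig_product_le_1(1)
  note EI = E[OF bm(1) upd(1) w(1,2)] E[OF bm(2) upd(1) w(3,4)] E[OF bm(3) upd(2) w(5,6)]
    I[OF bm(1) upd(1) w(1,2)] I[OF bm(2) upd(1) w(3,4)] I[OF bm(3) upd(2) w(5,6)]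
  ultimately show ?thesis
    by (simp only: Bochner_Integration.integral_add Bochner_Integration.integrable_add EI)
qed

lemma weight_sym: "weight u v = weight v u"
  using F_antisym by (rule pair_weight_sym)

lemma expectation_weight_Suc_half:
  assumes l: "l < K" and i: "i < 2 ^ K"
    and v: "\<And>p. p < 2 ^ K \<Longrightarrow> bounded_measurable (random_init K) (\<lambda>\<omega>. v \<omega> p)"
    and inv: "\<And>\<omega> t p. p < 2 ^ K \<Longrightarrow> v (fun_upd \<omega> (pair_angle l i) t) p = v \<omega> p"
  shows "(\<integral>\<omega>. weight (row K (Suc l) \<omega> i) (v \<omega>) \<partial>random_init K)
    = (\<integral>\<omega>. weight (row K l \<omega> i) (v \<omega>) \<partial>random_init K) / 2
      + (\<integral>\<omega>. weight (row K l \<omega> (flip l i)) (v \<omega>) \<partial>random_init K) / 2"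
proof -
  have "continuous_on UNIV (\<lambda>_::real. 1::real)" "norm (1::real) \<le> 1" by auto
  from expectation_weight_Suc[where u="\<lambda>_. 1", OF l i v inv this] show ?thesis
    by (simp only: mult_1_left double_angle_moments mult_zero_right add_0_right mult_1_right
        times_divide_eq_right)
qed

text \<open>Positions that neither coincide nor are partners use different rotation angles. Row
  \<open>a\<close> is averaged while row \<open>b\<close> stays fixed, then row \<open>b\<close>
  through the symmetry of the weight; interference drops out because \<open>cos x * sin x\<close>
  has mean 0.\<close>

lemma mean_weight_average:
  assumes l: "l < K" and a: "a < 2 ^ K" and b: "b < 2 ^ K" and ab: "a \<noteq> b" "b \<noteq> flip l a"
  shows "mean_weight (Suc l) a b
    = (mean_weight l a b + mean_weight l (flip l a) b + mean_weight l a (flip l b)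
       + mean_weight l (flip l a) (flip l b)) / 4"
proof -
  note one = expectation_weight_Suc_half
  have half: "(\<integral>\<omega>. weight (row K l \<omega> i) (row K (Suc l) \<omega> b) \<partial>random_init K)
      = (mean_weight l i b + mean_weight l i (flip l b)) / 2" if "i < 2 ^ K" for i
  proof -
    have "(\<integral>\<omega>. weight (row K (Suc l) \<omega> b) (row K l \<omega> i) \<partial>random_init K)
        = (\<integral>\<omega>. weight (row K l \<omega> b) (row K l \<omega> i) \<partial>random_init K) / 2
          + (\<integral>\<omega>. weight (row K l \<omega> (flip l b)) (row K l \<omega> i) \<partial>random_init K) / 2"
    proof (rule one[OF l b])
      show "bounded_measurable (random_init K) (\<lambda>\<omega>. row K l \<omega> i p)" if "p < 2 ^ K" for p
        using l \<open>i < 2 ^ K\<close> that by (intro bounded_measurable_row) auto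
    qed (simp only: butterfly_upto_fun_upd[OF lessI])
    then show ?thesis by (simp only: weight_sym[of "row K l _ i"] add_divide_distrib)
  qed
  have neq: "pair_angle l a \<noteq> pair_angle l b" using ab by (rule pair_angle_neq)
  have E: "mean_weight (Suc l) a b
      = (\<integral>\<omega>. weight (row K l \<omega> a) (row K (Suc l) \<omega> b) \<partial>random_init K) / 2
        + (\<integral>\<omega>. weight (row K l \<omega> (flip l a)) (row K (Suc l) \<omega> b) \<partial>random_init K) / 2"
  proof (rule one[OF l a])
    fix p :: nat assume p: "p < 2 ^ K"
    then show "bounded_measurable (random_init K) (\<lambda>\<omega>. row K (Suc l) \<omega> b p)"
      using l b by (intro bounded_measurable_row) auto
    show "row K (Suc l) (fun_upd \<omega> (pair_angle l a) t) b p = row K (Suc l) \<omega> b p" for \<omega> t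
      using neq by (intro row_Suc_fun_upd l b p) 
  qed
  show ?thesis unfolding E half[OF a] half[OF flip_less[OF l a]] by (simp add: field_simps)
qed

text \<open>Partner rows share one rotation, so the weights agree for every choice of angles, before
  averaging. The negative sine belongs to the smaller member, hence the reduction to
  \<open>a < flip l a\<close> by symmetry.\<close>

lemma mean_weight_flip:
  assumes l: "l < K" and a: "a < 2 ^ K"
  shows "mean_weight (Suc l) a (flip l a) = mean_weight l a (flip l a)"
proof -
  have lt: "weight (row K (Suc l) \<omega> a) (row K (Suc l) \<omega> (flip l a)) = weight (row K l \<omega> a) (row K l \<omega> (flip l a))"
    if a: "a < 2 ^ K" and "a < flip l a" for a \<omega>
  proof (rule pair_weight_rotate_both[OF F_antisym])
    let ?t = "\<omega> (pair_angle l a)" and ?e = "cis (- \<omega> (Phase (Suc l) a))"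
    let ?e' = "cis (- \<omega> (Phase (Suc l) (flip l a)))"
    fix p :: nat assume p: "p < 2 ^ K"
    show "row K (Suc l) \<omega> a p = complex_of_real (cos ?t) * (?e * row K l \<omega> a p)
        + complex_of_real (sin ?t) * (- ?e' * row K l \<omega> (flip l a) p)"
      using that by (subst row_Suc[OF l a p]) (simp add: phase_here_def phase_there_def)
    show "row K (Suc l) \<omega> (flip l a) p = complex_of_real (cos ?t) * (?e' * row K l \<omega> (flip l a) p)
        + complex_of_real (sin ?t) * (?e * row K l \<omega> a p)"
      using that by (subst row_Suc[OF l flip_less[OF l a] p])
        (simp add: phase_here_def phase_there_def flip_flip min.commute)
  qed simp_all
  have "weight (row K (Suc l) \<omega> a) (row K (Suc l) \<omega> (flip l a)) = weight (row K l \<omega> a) (row K l \<omega> (flip l a))" for \<omega>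
  proof (cases "a < flip l a")
    case True
    then show ?thesis using lt a by blast
  next
    case False
    then have "flip l a < flip l (flip l a)" using flip_neq[of a l] by (simp add: flip_flip)
    from lt[OF flip_less[OF l a] this] show ?thesis by (simp only: flip_flip weight_sym)
  qed
  then show ?thesis by (simp only:)
qed

lemma mean_weight_0:
  assumes "a < 2 ^ K" "b < 2 ^ K"
  shows "mean_weight 0 a b = (\<Sum>S\<in>X. (cmod (F a b S))\<^sup>2)"
proof -
  interpret P: prob_space "random_init K" by (rule prob_space_random_init)
  have "pair_amplitude (2 ^ K) F (row K 0 \<omega> a) (row K 0 \<omega> b) S = F a b S" for \<omega> S
  proof -
    have "pair_amplitude (2 ^ K) F (row K 0 \<omega> a) (row K 0 \<omega> b) S
      = (\<Sum>p<2 ^ K. \<Sum>q<2 ^ K. if q = b then (if p = a then F p q S else 0) else 0)"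
      unfolding pair_amplitude_def using assms by (intro sum.cong refl) auto
    then show ?thesis using assms by simp
  qed
  then have "weight (row K 0 \<omega> a) (row K 0 \<omega> b) = (\<Sum>S\<in>X. (cmod (F a b S))\<^sup>2)" for \<omega>
    unfolding pair_weight_def by simp
  then show ?thesis by (simp only: P.prob_space lebesgue_integral_const) simp
qed

text \<open>The test function \<open>sin 2\<theta> cos 2\<theta>'\<close>, with \<open>\<theta>\<close> and \<open>\<theta>'\<close> the last-layer angles of \<open>i\<close> and \<open>j\<close>,
  kills all interference terms.\<close>

lemma variance_partial_deriv_weight:
  assumes K: "K = Suc N" and i: "i < 2 ^ K" and j: "j < 2 ^ K" and ij: "i \<noteq> j" "j \<noteq> flip N i"
    and L: "\<And>\<omega>. L \<omega> = weight (row K K \<omega> i) (row K K \<omega> j)"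
  defines "d \<equiv> mean_weight N i j + mean_weight N (flip N i) (flip N j)
      - mean_weight N (flip N i) j - mean_weight N i (flip N j)"
  shows "d\<^sup>2 / 16 \<le> prob_space.variance (random_init K) (partial_deriv L (pair_angle N i))"
proof -
  interpret P: prob_space "random_init K" by (rule prob_space_random_init)
  let ?\<theta> = "pair_angle N i" and ?\<theta>' = "pair_angle N j" and ?M = "random_init K"
  let ?rj = "\<lambda>\<omega>. row K K \<omega> j"
  have N: "N < K" using K by simp
  have i': "flip N i < 2 ^ K" and j': "flip N j < 2 ^ K" using flip_less[OF N] i j by auto
  have neq: "?\<theta> \<noteq> ?\<theta>'" using ij by (rule pair_angle_neq)
  have \<theta>: "?\<theta> \<in> angles K" and \<theta>': "?\<theta>' \<in> angles K"
    using pair_angle_rbs[OF N] i j by auto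
  have rj_upd: "row K K (fun_upd \<omega> ?\<theta> t) j p = row K K \<omega> j p" if "p < 2 ^ K" for \<omega> t p
    using row_Suc_fun_upd[OF N j that neq] by (simp only: K[symmetric])
  have rj_bm: "bounded_measurable ?M (\<lambda>\<omega>. row K K \<omega> j p)" if "p < 2 ^ K" for p
    using that j by (intro bounded_measurable_row) auto
  \<comment> \<open>\<open>A\<close> and \<open>C\<close> are the coefficients of
    \<open>sin (2 * theta)\<close> and \<open>cos (2 * theta)\<close> in the derivative. They do not
    involve \<open>theta\<close>, since row \<open>j\<close> belongs to another pair.\<close>
  define A where "A \<omega> = weight (row K N \<omega> (flip N i)) (?rj \<omega>) - weight (row K N \<omega> i) (?rj \<omega>)" for \<omega>
  define C where "C \<omega> = interference N i \<omega> (?rj \<omega>)" for \<omega>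
  have W_bm: "bounded_measurable ?M (\<lambda>\<omega>. weight (row K N \<omega> a) (?rj \<omega>))" if "a < 2 ^ K" for a
    using that N j by (intro bounded_measurable_pair_weight bounded_measurable_row) auto
  have A_bm: "bounded_measurable ?M A"
    unfolding A_def[abs_def] using i i' by (intro bounded_measurable_diff W_bm)
  have C_bm: "bounded_measurable ?M C"
    unfolding C_def[abs_def] using N i rj_bm by (intro bounded_measurable_interference)
  have W_upd: "weight (row K N (fun_upd \<omega> ?\<theta> t) a) (?rj (fun_upd \<omega> ?\<theta> t)) = weight (row K N \<omega> a) (?rj \<omega>)" for \<omega> t a
    unfolding butterfly_upto_fun_upd[OF lessI] by (rule pair_weight_cong) (simp_all only: rj_upd)
  have C_upd: "C (fun_upd \<omega> ?\<theta> t) = C \<omega>" for \<omega> t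
    unfolding C_def butterfly_upto_fun_upd[OF lessI] phase_fun_upd
    by (rule pair_cross_cong) (simp only: rj_upd)
  have A_upd: "A (fun_upd \<omega> ?\<theta> t) = A \<omega>" for \<omega> t
    by (simp only: A_def W_upd)
  have deriv: "partial_deriv L ?\<theta> \<omega> = A \<omega> * sin (2 * \<omega> ?\<theta>) + C \<omega> * cos (2 * \<omega> ?\<theta>)" for \<omega>
  proof -
    have "L (fun_upd \<omega> ?\<theta> t) = weight (row K N \<omega> i) (?rj \<omega>) * (cos t)\<^sup>2
        + weight (row K N \<omega> (flip N i)) (?rj \<omega>) * (sin t)\<^sup>2 + C \<omega> * (cos t * sin t)" for t
    proof -
      have "L (fun_upd \<omega> ?\<theta> t) = weight (row K (Suc N) (fun_upd \<omega> ?\<theta> t) i) (?rj (fun_upd \<omega> ?\<theta> t))"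
        by (simp only: L K[symmetric])
      then show ?thesis
        unfolding weight_row_Suc[OF N i] W_upd C_def[symmetric] C_upd fun_upd_same .
    qed
    then have "((\<lambda>t. L (fun_upd \<omega> ?\<theta> t)) has_real_derivative
        weight (row K N \<omega> i) (?rj \<omega>) * (2 * cos t * - sin t)
        + weight (row K N \<omega> (flip N i)) (?rj \<omega>) * (2 * sin t * cos t)
        + C \<omega> * (- sin t * sin t + cos t * cos t)) (at t)" for t
      by (simp only:) (auto intro!: derivative_eq_intros)
    from DERIV_imp_deriv[OF this[of "\<omega> ?\<theta>"]] show ?thesis
      unfolding partial_deriv_def
      by (simp add: A_def sin_double cos_double power2_eq_square algebra_simps)
  qed
  define g where "g \<omega> = cos (2 * \<omega> ?\<theta>') * sin (2 * \<omega> ?\<theta>)" for \<omega> :: "angle \<Rightarrow> real"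
  note trig = bounded_measurable_trig_angle[OF N i, of 2] bounded_measurable_trig_angle[OF N j, of 2]
  have cont: "continuous_on UNIV (\<lambda>x::real. sin (2 * x))" "continuous_on UNIV (\<lambda>x::real. cos (2 * x))"
    "continuous_on UNIV (\<lambda>x::real. (sin (2 * x))\<^sup>2)" "continuous_on UNIV (\<lambda>x::real. (cos (2 * x))\<^sup>2)"
    "continuous_on UNIV (\<lambda>x::real. cos (2 * x) * sin (2 * x))"
    by (intro continuous_intros)+
  have le1: "norm (sin (2 * x)) \<le> 1" "norm (cos (2 * x)) \<le> 1" for x :: real by auto
  have X_bm: "bounded_measurable ?M (partial_deriv L ?\<theta>)"
    unfolding deriv[abs_def]
    by (intro bounded_measurable_add bounded_measurable_mult A_bm C_bm trig)
  have g_bm: "bounded_measurable ?M g"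
    unfolding g_def[abs_def] by (intro bounded_measurable_mult trig)
  have "P.expectation g = 0"
    using expectation_independent_angle[OF \<theta> trig(3) _ cont(1) le1(1)] neq
    by (simp add: g_def[abs_def] double_angle_moments)
  moreover have "P.expectation (\<lambda>\<omega>. (g \<omega>)\<^sup>2) = 1 / 4"
  proof -
    have "P.expectation (\<lambda>\<omega>. (cos (2 * \<omega> ?\<theta>'))\<^sup>2 * (sin (2 * \<omega> ?\<theta>))\<^sup>2)
        = P.expectation (\<lambda>\<omega>. (cos (2 * \<omega> ?\<theta>'))\<^sup>2) * (1 / 2)"
      using expectation_independent_angle[OF \<theta> bounded_measurable_power2[OF trig(3)] _ cont(3) trig_product_le_1(3)] neq
      by (simp add: double_angle_moments)
    moreover have "P.expectation (\<lambda>\<omega>. (cos (2 * \<omega> ?\<theta>'))\<^sup>2) = 1 / 2"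
      using expectation_independent_angle[OF \<theta>' bounded_measurable_const[of _ 1] _ cont(4) trig_product_le_1(2)]
      by (simp add: double_angle_moments P.prob_space)
    ultimately show ?thesis by (simp add: g_def power_mult_distrib)
  qed
  \<comment> \<open>The factor 8 splits into 2, from the mean of the squared sine, and 4, from the
    average against the cosine of the other angle.\<close>
  moreover have "P.expectation (\<lambda>\<omega>. partial_deriv L ?\<theta> \<omega> * g \<omega>) = - d / 8"
  proof -
    have Ac: "bounded_measurable ?M (\<lambda>\<omega>. A \<omega> * cos (2 * \<omega> ?\<theta>'))"
      and Cc: "bounded_measurable ?M (\<lambda>\<omega>. C \<omega> * cos (2 * \<omega> ?\<theta>'))"
      by (intro bounded_measurable_mult A_bm C_bm trig)+
    have "(\<lambda>\<omega>. partial_deriv L ?\<theta> \<omega> * g \<omega>) = (\<lambda>\<omega>. A \<omega> * cos (2 * \<omega> ?\<theta>') * (sin (2 * \<omega> ?\<theta>))\<^sup>2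
        + C \<omega> * cos (2 * \<omega> ?\<theta>') * (cos (2 * \<omega> ?\<theta>) * sin (2 * \<omega> ?\<theta>)))"
      by (auto simp: deriv g_def power2_eq_square algebra_simps)
    moreover have "P.expectation \<dots>
        = P.expectation (\<lambda>\<omega>. A \<omega> * cos (2 * \<omega> ?\<theta>') * (sin (2 * \<omega> ?\<theta>))\<^sup>2)
          + P.expectation (\<lambda>\<omega>. C \<omega> * cos (2 * \<omega> ?\<theta>') * (cos (2 * \<omega> ?\<theta>) * sin (2 * \<omega> ?\<theta>)))"
      by (intro Bochner_Integration.integral_add P.integrable_bounded_measurable
          bounded_measurable_mult[OF Ac] bounded_measurable_mult[OF Cc] bounded_measurable_power2
          bounded_measurable_mult trig)
    moreover have "P.expectation (\<lambda>\<omega>. A \<omega> * cos (2 * \<omega> ?\<theta>') * (sin (2 * \<omega> ?\<theta>))\<^sup>2)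
        = P.expectation (\<lambda>\<omega>. A \<omega> * cos (2 * \<omega> ?\<theta>')) * (1 / 2)"
      using expectation_independent_angle[OF \<theta> Ac _ cont(3) trig_product_le_1(3)] neq
      by (simp add: double_angle_moments A_upd)
    moreover have "P.expectation (\<lambda>\<omega>. C \<omega> * cos (2 * \<omega> ?\<theta>') * (cos (2 * \<omega> ?\<theta>) * sin (2 * \<omega> ?\<theta>))) = 0"
      using expectation_independent_angle[OF \<theta> Cc _ cont(5) trig_product_le_1(1)] neq
      by (simp add: double_angle_moments C_upd)
    moreover have "P.expectation (\<lambda>\<omega>. A \<omega> * cos (2 * \<omega> ?\<theta>')) = - d / 4"
    proof -
      \<comment> \<open>The test factor weights the two branches of row \<open>j\<close> by
        \<open>1 / 4\<close> and \<open>- 1 / 4\<close>, which leaves a difference of means over the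
        flip of \<open>j\<close>.\<close>
      have e: "P.expectation (\<lambda>\<omega>. weight (row K N \<omega> a) (?rj \<omega>) * cos (2 * \<omega> ?\<theta>'))
          = (mean_weight N a j - mean_weight N a (flip N j)) / 4" if a: "a < 2 ^ K" for a
      proof -
        have "P.expectation (\<lambda>\<omega>. cos (2 * \<omega> ?\<theta>') * weight (row K (Suc N) \<omega> j) (row K N \<omega> a))
            = mean_weight N j a * (1 / 4) + mean_weight N (flip N j) a * (- 1 / 4)
              + P.expectation (\<lambda>\<omega>. interference N j \<omega> (row K N \<omega> a)) * 0"
        proof -
          have v: "bounded_measurable ?M (\<lambda>\<omega>. row K N \<omega> a p)" if "p < 2 ^ K" for p
            using N a that by (intro bounded_measurable_row) auto
          have inv: "row K N (fun_upd \<omega> ?\<theta>' t) a p = row K N \<omega> a p" for \<omega> t p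
            by (simp only: butterfly_upto_fun_upd[OF lessI])
          show ?thesis
            using expectation_weight_Suc[where v="\<lambda>\<omega>. row K N \<omega> a", OF N j v inv cont(2) le1(2)]
            by (simp only: double_angle_moments)
        qed
        then show ?thesis
          by (simp add: K[symmetric] weight_sym[of "row K N _ a"] mult.commute diff_divide_distrib
            del: butterfly_upto.simps)
      qed
      have "P.expectation (\<lambda>\<omega>. A \<omega> * cos (2 * \<omega> ?\<theta>'))
          = P.expectation (\<lambda>\<omega>. weight (row K N \<omega> (flip N i)) (?rj \<omega>) * cos (2 * \<omega> ?\<theta>'))
            - P.expectation (\<lambda>\<omega>. weight (row K N \<omega> i) (?rj \<omega>) * cos (2 * \<omega> ?\<theta>'))"
        unfolding A_def left_diff_distrib
        by (intro Bochner_Integration.integral_diff P.integrable_bounded_measurable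
            bounded_measurable_mult W_bm i i' trig)
      then show ?thesis unfolding e[OF i] e[OF i'] d_def by (simp add: field_simps)
    qed
    ultimately show ?thesis by simp
  qed
  ultimately show ?thesis
    using P.variance_ge_covariance[OF X_bm g_bm] by (simp add: power_divide)
qed

end

section \<open>From the loss to the variance bound\<close>

lemma loss_eq_pair_weight:
  assumes "i < 2 ^ K" "j < 2 ^ K" "i \<noteq> j"
  shows "loss K (Suc (Suc k)) \<phi> i j \<omega> = pair_weight (2 ^ K) (k_sets (2 ^ K) k)
    (\<lambda>p q. annihilation p (annihilation q (encoded_state K (Suc (Suc k)) \<phi>)))
    (row K K \<omega> i) (row K K \<omega> j)"
  unfolding loss_def Let_def butterfly_def pair_weight_def pair_amplitude_def
  using assms by (intro pair_correlator_ext_power norm_preserving_butterfly_upto) (auto simp: dim_butterfly_upto)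

theorem theorem17:
  fixes K k n :: nat and \<phi> :: "'x \<Rightarrow> nat \<Rightarrow> real" and x :: 'x
  assumes "n = 2 ^ K" and "even k" and "k \<ge> 2" and "4 * k \<le> n"
  shows "\<exists>i j \<theta>. i < n \<and> j < n \<and> i \<noteq> j \<and> \<theta> \<in> rbs_angles K \<and>
           prob_space.variance (random_init K) (partial_deriv (loss K k (\<phi> x) i j) \<theta>)
             \<ge> (real k)\<^sup>2 * (real k - 1)\<^sup>2 / (2 * real n ^ 6)"
proof -
  obtain m where "k = 2 * m" "m \<ge> 1" using assms(2,3) by (elim evenE) auto
  then obtain k' where k': "k = Suc (Suc (2 * k'))" "k = 2 * Suc k'"
    by (cases m) auto
  \<comment> \<open>This ensures \<open>N >= 1\<close>, so that there is a layer before the last one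
    in which exclusion can act.\<close>
  have "(8::nat) \<le> 2 ^ K" using assms by simp
  then obtain N where K: "K = Suc N" and N: "N \<ge> 1"
  proof (cases K)
    case (Suc N)
    then show ?thesis using that \<open>8 \<le> 2 ^ K\<close> by (cases N) auto
  qed simp
  let ?\<eta> = "encoded_state K k (\<phi> x)"
  define F where "F p q = annihilation p (annihilation q ?\<eta>)" for p q
  let ?X = "k_sets (2 ^ K) (2 * k')"
  define P where "P a b = (\<Sum>S\<in>?X. (cmod (F a b S))\<^sup>2)" for a b
  define s where "s = real k * (real k - 1)"
  have anti: "F p q S = - F q p S" for p q S
    unfolding F_def by (rule annihilation_anticommute)
  \<comment> \<open>Half of \<open>4 * k <= n\<close>: the input occupies \<open>2 * k\<close>
    modes, which fit into the lower \<open>n / 2 = 2 ^ N\<close>.\<close>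
  have h: "4 * Suc k' \<le> 2 ^ N" using assms K k' by simp
  have F_flip: "cmod (F (flip N a) b S) = cmod (F a b S)" if "a < 2 ^ K" for a b S
  proof -
    \<comment> \<open>The phase relation concerns the inner annihilation, the one acting directly on
      the encoded state; antisymmetry then carries it to the first index.\<close>
    have "F b (flip N a) S = cis (\<phi> x a - \<phi> x (flip N a)) * F b a S"
      unfolding F_def k'(2) K annihilation_encoded_flip[OF h that[unfolded K]]
      by (rule annihilation_scale)
    then show ?thesis unfolding anti[of _ b] by (simp add: norm_mult)
  qed
  have P_sum: "(\<Sum>a<2 ^ K. \<Sum>b<2 ^ K. P a b) = s"
  proof -
    have "(\<Sum>a<2 ^ K. \<Sum>b<2 ^ K. P a b) = (\<Sum>b<2 ^ K. \<Sum>a<2 ^ K. P a b)" by (rule sum.swap)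
    \<comment> \<open>Each annihilation contributes a particle number: \<open>k - 1\<close> for the
      outer one, then \<open>k\<close> for the inner one.\<close>
    also have "\<dots> = real (Suc (2 * k')) * (\<Sum>b<2 ^ K. \<Sum>S\<in>k_sets (2 ^ K) (Suc (2 * k')). (cmod (annihilation b ?\<eta> S))\<^sup>2)"
      by (simp only: P_def F_def sum_norm_annihilation[where k="2 * k'"] sum_distrib_left[symmetric])
    also have "\<dots> = real (Suc (2 * k')) * (real k * (\<Sum>S\<in>k_sets (2 ^ K) k. (cmod (?\<eta> S))\<^sup>2))"
      by (simp only: sum_norm_annihilation[where k="Suc (2 * k')"] k'(1)[symmetric])
    also have "(\<Sum>S\<in>k_sets (2 ^ K) k. (cmod (?\<eta> S))\<^sup>2) = 1"
      unfolding k'(2) using h K by (intro norm_encoded_state) simp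
    finally show ?thesis using k'(1) by (simp add: s_def)
  qed
  let ?q = "\<lambda>l a b. \<integral>\<omega>. pair_weight (2 ^ K) ?X F (row K l \<omega> a) (row K l \<omega> b) \<partial>random_init K"
  have "\<exists>a m. a < 2 ^ K \<and> m < N \<and> 4 * s / (2 ^ K) ^ 3
    \<le> ?q N a (flip m a) + ?q N (flip N a) (flip N (flip m a))
      - ?q N (flip N a) (flip m a) - ?q N a (flip N (flip m a))"
  proof (rule exists_large_defect[where q="?q" and P=P, OF K])
    show "P a a = 0" for a
      using anti[of a a] by (simp add: P_def eq_neg_iff_add_eq_0 flip: mult_2)
    show "P a b = P b a" for a b
      unfolding P_def by (subst anti) simp
    show "s \<ge> 0" using assms(3) by (simp add: s_def)
    show "P (flip N a) b = P a b" if "a < 2 ^ K" for a b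
      using that by (simp add: P_def F_flip)
    show "?q 0 a b = P a b" if "a < 2 ^ K" "b < 2 ^ K" for a b
      unfolding P_def by (rule mean_weight_0[OF anti that])
    show "?q (Suc l) a (flip l a) = ?q l a (flip l a)" if "l < K" "a < 2 ^ K" for l a
      by (rule mean_weight_flip[OF anti that])
    show "?q (Suc l) a b = (?q l a b + ?q l (flip l a) b + ?q l a (flip l b) + ?q l (flip l a) (flip l b)) / 4"
      if "l < K" "a < 2 ^ K" "b < 2 ^ K" "a \<noteq> b" "b \<noteq> flip l a" for l a b
      by (rule mean_weight_average[OF anti that])
  qed (fact P_sum N)+
  then obtain a m where a: "a < 2 ^ K" and m: "m < N" and d: "4 * s / (2 ^ K) ^ 3
    \<le> ?q N a (flip m a) + ?q N (flip N a) (flip N (flip m a))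
      - ?q N (flip N a) (flip m a) - ?q N a (flip N (flip m a))" (is "_ \<le> ?d") by blast
  have j: "flip m a < 2 ^ K" "a \<noteq> flip m a" "flip m a \<noteq> flip N a"
  proof -
    show "flip m a < 2 ^ K" using m K a by (intro flip_less) auto
    show "a \<noteq> flip m a" using flip_neq by metis
    have "bit (flip m a) m \<noteq> bit (flip N a) m" using m by (auto simp: bit_flip)
    then show "flip m a \<noteq> flip N a" by auto
  qed
  have loss: "loss K k (\<phi> x) a (flip m a) \<omega>
      = pair_weight (2 ^ K) ?X F (row K K \<omega> a) (row K K \<omega> (flip m a))" for \<omega>
    using loss_eq_pair_weight[OF a j(1,2)] unfolding k'(1) F_def by blast
  \<comment> \<open>The 4 of the defect, squared, meets the 16 of the covariance bound, leaving
    \<open>s^2 / n^6\<close>, twice the claimed value.\<close>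
  have "s\<^sup>2 / (2 * real n ^ 6) \<le> (4 * s / (2 ^ K) ^ 3)\<^sup>2 / 16"
  proof -
    have "(4 * s / (2 ^ K) ^ 3)\<^sup>2 / 16 = s\<^sup>2 / real n ^ 6"
      unfolding assms(1) by (simp add: power_divide power_mult_distrib flip: power_mult)
    moreover have "s\<^sup>2 / (2 * real n ^ 6) \<le> s\<^sup>2 / real n ^ 6"
      using assms(1) by (intro divide_left_mono) auto
    ultimately show ?thesis by simp
  qed
  also have "\<dots> \<le> ?d\<^sup>2 / 16"
    using d assms(3) by (intro divide_right_mono power_mono) (auto simp: s_def)
  also have "\<dots> \<le> prob_space.variance (random_init K)
      (partial_deriv (loss K k (\<phi> x) a (flip m a)) (pair_angle N a))"
    using anti by (intro variance_partial_deriv_weight[OF _ K a j loss])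
  finally have "s\<^sup>2 / (2 * real n ^ 6) \<le> prob_space.variance (random_init K)
      (partial_deriv (loss K k (\<phi> x) a (flip m a)) (pair_angle N a))" .
  moreover have "pair_angle N a \<in> rbs_angles K" using K a by (intro pair_angle_rbs) auto
  ultimately show ?thesis using a j assms(1) by (auto simp: s_def power_mult_distrib)
qed

end
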